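(* Let $\mathbf C$ be an ordered collection of $g\ge1$ distinct real points, let $A\in\mathrm{GMP}(\mathbf C)$, and let $\{A(n)\}_{n\in\mathbb Z}\subset\mathrm{GMP}(\mathbf C)$ be the orbit of $A$ under the Jacobi flow, $A(0)=A$, $A(n+1)=\mathcal JA(n)$. Let $\vec p_j(n)=(p^{(j)}_0(n),\dots,p^{(j)}_g(n))^*$, $\vec q_j(n)=(q^{(j)}_0(n),\dots,q^{(j)}_g(n))^*$, $j\in\mathbb Z$, be the generating coefficients of $A(n)$. Let $J=\mathcal FA$ be the two-sided Jacobi matrix associated with $A$, $Je_n=a(n)e_{n-1}+b(n)e_n+a(n+1)e_{n+1}$. Then $$a(n)=\|\vec p_0(n)\|,\qquad b(n-1)=q_g^{(-1)}(n)\,p_g^{(-1)}(n).$$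
   Context: GMP matrices: $\{e_n\}_{n\in\mathbb Z}$ is the standard basis of $\ell^2=\ell^2(\mathbb Z)$, $Se_n=e_{n+1}$, $\ell^2_+$ is the closed span of $\{e_n\}_{n\ge0}$, $\ell^2_-=\ell^2\ominus\ell^2_+$, $P_\pm$ are the orthogonal projections; $\delta_0,\dots,\delta_g$ is the standard basis of $\mathbb C^{g+1}$. For a square matrix $T$, $T^-$ is its strictly upper triangular part and $T^+=T-T^-$. For an ordered collection $\mathbf C=\{\mathbf c_1,\dots,\mathbf c_g\}$ of distinct real points, a bounded operator $A$ on $\ell^2$ is of class $\mathbb A(\mathbf C)$ if it is block tridiagonal with $(g+1)\times(g+1)$ blocks (block $j$ occupying indices $j(g+1),\dots,j(g+1)+g$), with $(j,j)$ block $B(\vec{\mathbf p}_j)$, $(j-1,j)$ block $A(\vec p_j)$, $(j,j-1)$ block $A(\vec p_j)^*$, where $\vec{\mathbf p}_j=(\vec p_j,\vec q_j)\in\mathbb R^{2g+2}$, $p^{(j)}_g>0$, and $$A(\vec p)=\delta_g\vec p^{\,*},\qquad B(\vec{\mathbf p})=(\vec q\,\vec p^{\,*})^-+(\vec p\,\vec q^{\,*})^++\mathrm{diag}(\mathbf c_1,\dots,\mathbf c_g,0).$$ $\{\vec{\mathbf p}_j\}$ are the generating coefficients. $A\in\mathbb A(\mathbf C)$ belongs to $\mathrm{GMP}(\mathbf C)$ if for every $k=1,\dots,g$ the operator $\mathbf c_k-A$ is boundedly invertible and $S^{-k}(\mathbf c_k-A)^{-1}S^k$ is again of class $\mathbb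 A(\mathbf C_k)$ for some ordered collection $\mathbf C_k$ of $g$ distinct real points. The map $\mathcal F$: for $A\in\mathrm{GMP}(\mathbf C)$ let $A_\pm=P_\pm A|_{\ell^2_\pm}$, $\tilde e_{-1}=e_{-1}$, $\tilde e_0=\frac1{\|\vec p_0\|}P_+Ae_{-1}$. The two-sided Jacobi matrix $J=\mathcal FA$ (with $a(n)>0$) is uniquely defined by: $a(0)=\|\vec p_0\|$, $\langle(J_+-z)^{-1}e_0,e_0\rangle=\langle(A_+-z)^{-1}\tilde e_0,\tilde e_0\rangle$ and $\langle(J_--z)^{-1}e_{-1},e_{-1}\rangle=\langle(A_--z)^{-1}\tilde e_{-1},\tilde e_{-1}\rangle$, where $J_\pm=P_\pm J|_{\ell^2_\pm}$. Jacobi flow: for a vector $\vec p=(p_0,\dots,p_g)^*$ with $p_g>0$ put $d_k\vec p=(p_k,\dots,p_g)^*$ and let $U(\vec p)$ be the orthogonal matrix with columns $$U(\vec p)\delta_0=\frac{\vec p}{\|\vec p\|},\qquad U(\vec p)\delta_k=\frac1{\|d_{k-1}\vec p\|\,\|d_k\vec p\|}\begin{bmatrix}0_{k-1}\\ \|d_k\vec p\|^2\\ -p_{k-1}d_k\vec p\end{bmatrix},\quad 1\le k\le g,$$ ($0_{k-1}$ is the zero column of length $k-1$). Let $U_A$ be the block diagonal matrix with $j$-th diagonal block $U(\vec p_j)$. Then $\mathcal JA=S^{-1}U_A^*AU_AS$; it maps $\mathrm{GMP}(\mathbf C)$ into itself and satisfies $\mathcal F(\mathcal JA)=S^{-1}(\mathcal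 FA)S$. *)

theory Defs
  imports "HOL-Analysis.Analysis"
begin

section \<open>The complex Hilbert space of square-summable sequences over the integers\<close>

typedef ell2 = "{x :: int \<Rightarrow> complex. (\<lambda>n. (cmod (x n))\<^sup>2) summable_on UNIV}"
  morphisms ell2_nth Abs_ell2
  by (rule exI[of _ "\<lambda>_. 0"]) simp

setup_lifting type_definition_ell2

lemma ell2_nth_summable: "(\<lambda>n. (cmod (ell2_nth x n))\<^sup>2) summable_on UNIV"
  using ell2_nth[of x] by simp

lemma square_summable_add:
  fixes x y :: "int \<Rightarrow> complex"
  assumes "(\<lambda>n. (cmod (x n))\<^sup>2) summable_on UNIV" "(\<lambda>n. (cmod (y n))\<^sup>2) summable_on UNIV"
  shows "(\<lambda>n. (cmod (x n + y n))\<^sup>2) summable_on UNIV"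
proof (rule summable_on_comparison_test)
  show "(\<lambda>n. 2 * (cmod (x n))\<^sup>2 + 2 * (cmod (y n))\<^sup>2) summable_on UNIV"
    by (intro summable_on_add summable_on_cmult_right assms)
  fix n :: int
  have "(cmod (x n + y n))\<^sup>2 \<le> (cmod (x n) + cmod (y n))\<^sup>2"
    by (intro power_mono norm_triangle_ineq) simp
  also have "\<dots> \<le> 2 * (cmod (x n))\<^sup>2 + 2 * (cmod (y n))\<^sup>2"
    using zero_le_power2[of "cmod (x n) - cmod (y n)"] by (simp add: power2_eq_square algebra_simps)
  finally show "(cmod (x n + y n))\<^sup>2 \<le> 2 * (cmod (x n))\<^sup>2 + 2 * (cmod (y n))\<^sup>2" .
qed simp

lemma square_summable_cmult:
  fixes x :: "int \<Rightarrow> complex"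
  assumes "(\<lambda>n. (cmod (x n))\<^sup>2) summable_on UNIV"
  shows "(\<lambda>n. (cmod (c * x n))\<^sup>2) summable_on UNIV"
  using summable_on_cmult_right[OF assms, of "(cmod c)\<^sup>2"] by (simp add: norm_mult power_mult_distrib)

lemma square_summable_abs_summable_cnj:
  fixes x y :: "int \<Rightarrow> complex"
  assumes "(\<lambda>n. (cmod (x n))\<^sup>2) summable_on UNIV" "(\<lambda>n. (cmod (y n))\<^sup>2) summable_on UNIV"
  shows "(\<lambda>n. norm (x n * cnj (y n))) summable_on UNIV"
proof (rule summable_on_comparison_test)
  show "(\<lambda>n. (cmod (x n))\<^sup>2 + (cmod (y n))\<^sup>2) summable_on UNIV"
    by (rule summable_on_add[OF assms])
  fix n :: int
  have "2 * (cmod (x n) * cmod (y n)) \<le> (cmod (x n))\<^sup>2 + (cmod (y n))\<^sup>2"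
    using zero_le_power2[of "cmod (x n) - cmod (y n)"] by (simp add: power2_eq_square algebra_simps)
  moreover have "0 \<le> cmod (x n) * cmod (y n)" by simp
  ultimately have "cmod (x n) * cmod (y n) \<le> (cmod (x n))\<^sup>2 + (cmod (y n))\<^sup>2"
    by linarith
  then show "norm (x n * cnj (y n)) \<le> (cmod (x n))\<^sup>2 + (cmod (y n))\<^sup>2"
    by (simp add: norm_mult)
qed simp

definition cinner :: "ell2 \<Rightarrow> ell2 \<Rightarrow> complex" where
  "cinner x y = (\<Sum>\<^sub>\<infinity>n. ell2_nth x n * cnj (ell2_nth y n))"

lift_definition cscale :: "complex \<Rightarrow> ell2 \<Rightarrow> ell2" is "\<lambda>c x n. c * x n"
  using square_summable_cmult by simp

text \<open>The library has no class of complex Hilbert spaces, so \<open>ell2\<close> is made a real inner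
  product space, whose norm is the usual one; complex homogeneity is stated separately.\<close>

instantiation ell2 :: real_inner
begin

lift_definition zero_ell2 :: ell2 is "\<lambda>_. 0" by simp

lift_definition plus_ell2 :: "ell2 \<Rightarrow> ell2 \<Rightarrow> ell2" is "\<lambda>x y n. x n + y n"
  using square_summable_add by simp

lift_definition uminus_ell2 :: "ell2 \<Rightarrow> ell2" is "\<lambda>x n. - x n" by simp

lift_definition minus_ell2 :: "ell2 \<Rightarrow> ell2 \<Rightarrow> ell2" is "\<lambda>x y n. x n - y n"
proof -
  fix x y :: "int \<Rightarrow> complex"
  assume "(\<lambda>n. (cmod (x n))\<^sup>2) summable_on UNIV"
    and "(\<lambda>n. (cmod (y n))\<^sup>2) summable_on UNIV"
  then show "(\<lambda>n. (cmod (x n - y n))\<^sup>2) summable_on UNIV"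
    using square_summable_add[of x "\<lambda>n. - y n"] by simp
qed

definition scaleR_ell2 :: "real \<Rightarrow> ell2 \<Rightarrow> ell2" where
  "scaleR_ell2 r x = cscale (of_real r) x"

definition inner_ell2 :: "ell2 \<Rightarrow> ell2 \<Rightarrow> real" where
  "inner_ell2 x y = Re (cinner x y)"

definition norm_ell2 :: "ell2 \<Rightarrow> real" where "norm_ell2 x = sqrt (inner x x)"

definition dist_ell2 :: "ell2 \<Rightarrow> ell2 \<Rightarrow> real" where "dist_ell2 x y = norm (x - y)"

definition sgn_ell2 :: "ell2 \<Rightarrow> ell2" where "sgn_ell2 x = inverse (norm x) *\<^sub>R x"

definition uniformity_ell2 :: "(ell2 \<times> ell2) filter" where
  "uniformity_ell2 = (INF e\<in>{0<..}. principal {(x, y). dist x y < e})"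

definition open_ell2 :: "ell2 set \<Rightarrow> bool" where
  "open_ell2 U \<longleftrightarrow> (\<forall>x\<in>U. eventually (\<lambda>(x', y). x' = x \<longrightarrow> y \<in> U) uniformity)"

lemma cinner_summable: "(\<lambda>n. ell2_nth x n * cnj (ell2_nth y n)) summable_on UNIV"
  by (rule abs_summable_summable[OF square_summable_abs_summable_cnj[OF ell2_nth_summable ell2_nth_summable]])

lemma inner_ell2_self: "inner x x = (\<Sum>\<^sub>\<infinity>n. (cmod (ell2_nth x n))\<^sup>2)"
proof -
  have "(\<Sum>\<^sub>\<infinity>n. Re (ell2_nth x n * cnj (ell2_nth x n))) = Re (cinner x x)"
    unfolding cinner_def by (rule infsum_Re[OF cinner_summable])
  then show ?thesis by (simp add: inner_ell2_def complex_norm_square[symmetric] del: of_real_power)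
qed

instance
proof
  fix x y z :: ell2 and r s :: real
  show "dist x y = norm (x - y)" by (rule dist_ell2_def)
  show "x + y + z = x + (y + z)" by transfer (simp add: algebra_simps)
  show "x + y = y + x" by transfer (simp add: algebra_simps)
  show "0 + x = x" by transfer simp
  show "- x + x = 0" by transfer simp
  show "x - y = x + - y" by transfer simp
  show "r *\<^sub>R (x + y) = r *\<^sub>R x + r *\<^sub>R y"
    unfolding scaleR_ell2_def by transfer (simp add: algebra_simps)
  show "(r + s) *\<^sub>R x = r *\<^sub>R x + s *\<^sub>R x"
    unfolding scaleR_ell2_def by transfer (simp add: algebra_simps)
  show "r *\<^sub>R s *\<^sub>R x = (r * s) *\<^sub>R x"
    unfolding scaleR_ell2_def by transfer (simp add: algebra_simps)
  show "1 *\<^sub>R x = x" unfolding scaleR_ell2_def by transfer simp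
  show "sgn x = inverse (norm x) *\<^sub>R x" by (rule sgn_ell2_def)
  show "uniformity = (INF e\<in>{0<..}. principal {(x, y). dist x (y::ell2) < e})"
    by (rule uniformity_ell2_def)
  show "open U \<longleftrightarrow> (\<forall>x\<in>U. eventually (\<lambda>(x', y). x' = x \<longrightarrow> y \<in> U) uniformity)" for U :: "ell2 set"
    by (rule open_ell2_def)
  have "cinner y x = cnj (cinner x y)"
    unfolding cinner_def by (subst infsum_cnj[symmetric]) (simp add: mult.commute)
  then show "inner x y = inner y x" by (simp add: inner_ell2_def)
  have "cinner (x + y) z = cinner x z + cinner y z"
    unfolding cinner_def
    by (simp add: plus_ell2.rep_eq ring_distribs infsum_add cinner_summable)
  then show "inner (x + y) z = inner x z + inner y z" by (simp add: inner_ell2_def)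
  have "cinner (r *\<^sub>R x) y = of_real r * cinner x y"
    unfolding cinner_def scaleR_ell2_def cscale.rep_eq
    by (simp add: mult.assoc infsum_cmult_right cinner_summable)
  then show "inner (r *\<^sub>R x) y = r * inner x y" by (simp add: inner_ell2_def)
  show "0 \<le> inner x x" unfolding inner_ell2_self by (rule infsum_nonneg) simp
  show "inner x x = 0 \<longleftrightarrow> x = 0"
  proof
    assume "inner x x = 0"
    then have "(cmod (ell2_nth x n))\<^sup>2 = 0" for n
      using nonneg_infsum_le_0D[of "\<lambda>n. (cmod (ell2_nth x n))\<^sup>2" UNIV n]
      by (simp add: inner_ell2_self ell2_nth_summable)
    then have "ell2_nth x = ell2_nth 0" by (auto simp: zero_ell2.rep_eq)
    then show "x = 0" by (simp add: ell2_nth_inject)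
  qed (simp add: inner_ell2_self zero_ell2.rep_eq)
  show "norm x = sqrt (inner x x)" by (rule norm_ell2_def)
qed

end

section \<open>Operators\<close>

lift_definition basis_vec :: "int \<Rightarrow> ell2" is "\<lambda>m n. if n = m then 1 else 0"
proof -
  fix m :: int
  have "(\<lambda>n. (cmod (if n = m then 1 else 0))\<^sup>2) summable_on UNIV \<longleftrightarrow>
      (\<lambda>n. (cmod (if n = m then 1 else 0))\<^sup>2) summable_on {m}"
    by (rule summable_on_cong_neutral) auto
  then show "(\<lambda>n. (cmod (if n = m then 1 else 0))\<^sup>2) summable_on UNIV"
    by simp
qed

text \<open>\<open>shift k\<close> is the \<open>k\<close>-th power of \<open>S\<close>, for any integer \<open>k\<close>.\<close>

lift_definition shift :: "int \<Rightarrow> ell2 \<Rightarrow> ell2" is "\<lambda>k x n. x (n - k)"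
proof -
  fix k :: int and x :: "int \<Rightarrow> complex"
  assume "(\<lambda>n. (cmod (x n))\<^sup>2) summable_on UNIV"
  moreover have "bij (\<lambda>n::int. n - k)"
    by (rule bij_betw_byWitness[where f' = "\<lambda>n. n + k"]) auto
  ultimately show "(\<lambda>n. (cmod (x (n - k)))\<^sup>2) summable_on UNIV"
    using summable_on_reindex_bij_betw[of "\<lambda>n. n - k" UNIV UNIV "\<lambda>n. (cmod (x n))\<^sup>2"] by simp
qed

lift_definition proj :: "int set \<Rightarrow> ell2 \<Rightarrow> ell2" is "\<lambda>N x n. if n \<in> N then x n else 0"
proof -
  fix N :: "int set" and x :: "int \<Rightarrow> complex"
  assume "(\<lambda>n. (cmod (x n))\<^sup>2) summable_on UNIV"
  then show "(\<lambda>n. (cmod (if n \<in> N then x n else 0))\<^sup>2) summable_on UNIV"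
    by (rule summable_on_comparison_test) auto
qed

definition bounded_op :: "(ell2 \<Rightarrow> ell2) \<Rightarrow> bool" where
  "bounded_op T \<longleftrightarrow> bounded_linear T \<and> (\<forall>c x. T (cscale c x) = cscale c (T x))"

definition boundedly_invertible :: "(ell2 \<Rightarrow> ell2) \<Rightarrow> bool" where
  "boundedly_invertible T \<longleftrightarrow> bij T \<and> bounded_op (inv T)"

definition adjoint_op :: "(ell2 \<Rightarrow> ell2) \<Rightarrow> ell2 \<Rightarrow> ell2" where
  "adjoint_op T = (THE T'. \<forall>x y. cinner (T x) y = cinner x (T' y))"

definition entry :: "(ell2 \<Rightarrow> ell2) \<Rightarrow> int \<Rightarrow> int \<Rightarrow> complex" where
  "entry T m n = cinner (T (basis_vec n)) (basis_vec m)"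

text \<open>Entry \<open>(i, l)\<close>, with \<open>0 \<le> i, l \<le> g\<close>, of the \<open>(j, k)\<close> block of size \<open>g + 1\<close>.\<close>

definition block :: "nat \<Rightarrow> (ell2 \<Rightarrow> ell2) \<Rightarrow> int \<Rightarrow> int \<Rightarrow> nat \<Rightarrow> nat \<Rightarrow> complex" where
  "block g T j k i l = entry T (j * int (g + 1) + int i) (k * int (g + 1) + int l)"

text \<open>The abstraction function is meaningful here as soon as the blocks \<open>M j\<close> are uniformly
  bounded, in particular for the orthogonal blocks used below.\<close>

definition block_diag :: "nat \<Rightarrow> (int \<Rightarrow> nat \<Rightarrow> nat \<Rightarrow> real) \<Rightarrow> ell2 \<Rightarrow> ell2" where
  "block_diag g M x = Abs_ell2 (\<lambda>n.
     let j = n div int (g + 1); i = nat (n mod int (g + 1))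
     in \<Sum>l\<le>g. of_real (M j i l) * ell2_nth x (j * int (g + 1) + int l))"

section \<open>GMP matrices\<close>

text \<open>A vector of \<open>\<real>\<^sup>g\<^sup>+\<^sup>1\<close> is a function on \<open>nat\<close> of which only the values at \<open>0, \<dots>, g\<close> are used;
  a collection \<open>c\<^sub>1, \<dots>, c\<^sub>g\<close> is a list \<open>C\<close> with \<open>c\<^sub>k = C ! (k - 1)\<close>, so that \<open>g = length C\<close>.\<close>

definition A_mat :: "nat \<Rightarrow> (nat \<Rightarrow> real) \<Rightarrow> nat \<Rightarrow> nat \<Rightarrow> real" where
  "A_mat g p i l = (if i = g then 1 else 0) * p l"

definition B_mat :: "real list \<Rightarrow> (nat \<Rightarrow> real) \<Rightarrow> (nat \<Rightarrow> real) \<Rightarrow> nat \<Rightarrow> nat \<Rightarrow> real" where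
  "B_mat C p q i l =
     (if i < l then q i * p l else 0) + (if l \<le> i then p i * q l else 0)
     + (if i = l \<and> i < length C then C ! i else 0)"

definition generating_coeffs ::
    "real list \<Rightarrow> (ell2 \<Rightarrow> ell2) \<Rightarrow> (int \<Rightarrow> nat \<Rightarrow> real) \<Rightarrow> (int \<Rightarrow> nat \<Rightarrow> real) \<Rightarrow> bool" where
  "generating_coeffs C T p q \<longleftrightarrow>
     (let g = length C in \<forall>j. p j g > 0 \<and>
       (\<forall>i\<le>g. \<forall>l\<le>g.
          block g T j j i l = of_real (B_mat C (p j) (q j) i l) \<and>
          block g T (j - 1) j i l = of_real (A_mat g (p j) i l) \<and>
          block g T j (j - 1) i l = of_real (A_mat g (p j) l i) \<and>
          (\<forall>k. \<bar>j - k\<bar> \<ge> 2 \<longrightarrow> block g T j k i l = 0)))"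

definition class_A :: "real list \<Rightarrow> (ell2 \<Rightarrow> ell2) \<Rightarrow> bool" where
  "class_A C T \<longleftrightarrow> bounded_op T \<and> (\<exists>p q. generating_coeffs C T p q)"

definition GMP :: "real list \<Rightarrow> (ell2 \<Rightarrow> ell2) set" where
  "GMP C = {T. class_A C T \<and>
     (\<forall>k\<in>{1..length C}.
        let R = (\<lambda>x. cscale (of_real (C ! (k - 1))) x - T x) in
        boundedly_invertible R \<and>
        (\<exists>D. length D = length C \<and> distinct D \<and>
             class_A D (shift (- int k) \<circ> inv R \<circ> shift (int k))))}"

text \<open>The coefficients \<open>p j i\<close> with \<open>i \<le> g\<close> are determined by \<open>T\<close>; the choice only concerns the
  irrelevant values at \<open>i > g\<close>.\<close>

definition p_coeffs :: "real list \<Rightarrow> (ell2 \<Rightarrow> ell2) \<Rightarrow> int \<Rightarrow> nat \<Rightarrow> real" where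
  "p_coeffs C T = (SOME p. \<exists>q. generating_coeffs C T p q)"

section \<open>The associated Jacobi matrix\<close>

definition jacobi_matrix :: "(ell2 \<Rightarrow> ell2) \<Rightarrow> (int \<Rightarrow> real) \<Rightarrow> (int \<Rightarrow> real) \<Rightarrow> bool" where
  "jacobi_matrix J a b \<longleftrightarrow> bounded_op J \<and>
     (\<forall>n. a n > 0 \<and>
        J (basis_vec n) = a n *\<^sub>R basis_vec (n - 1) + b n *\<^sub>R basis_vec n + a (n + 1) *\<^sub>R basis_vec (n + 1))"

text \<open>\<open>\<langle>(T\<^sub>N - z)\<^sup>-\<^sup>1 v, v\<rangle>\<close>, where \<open>T\<^sub>N\<close> is the compression of \<open>T\<close> to the closed span \<open>range (proj N)\<close>
  of the \<open>basis_vec n\<close> with \<open>n \<in> N\<close>. For self-adjoint \<open>T\<close> and non-real \<open>z\<close> the map \<open>T\<^sub>N - z\<close> is a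
  bijection of that subspace, so \<open>inv_into\<close> is the genuine inverse.\<close>

definition resolvent_fun :: "int set \<Rightarrow> (ell2 \<Rightarrow> ell2) \<Rightarrow> ell2 \<Rightarrow> complex \<Rightarrow> complex" where
  "resolvent_fun N T v z =
     cinner (inv_into (range (proj N)) (\<lambda>x. proj N (T x) - cscale z x) v) v"

text \<open>\<open>associated_jacobi C T J\<close> expresses that \<open>J\<close> is the image of \<open>T\<close> under the map \<open>\<F>\<close>.\<close>

definition associated_jacobi :: "real list \<Rightarrow> (ell2 \<Rightarrow> ell2) \<Rightarrow> (ell2 \<Rightarrow> ell2) \<Rightarrow> bool" where
  "associated_jacobi C T J \<longleftrightarrow>
     (\<exists>a b. jacobi_matrix J a b \<and>
       (let p0 = L2_set (p_coeffs C T 0) {..length C};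
            e0 = (1 / p0) *\<^sub>R proj {0..} (T (basis_vec (- 1)))
        in a 0 = p0 \<and>
           (\<forall>z. Im z \<noteq> 0 \<longrightarrow>
              resolvent_fun {0..} J (basis_vec 0) z = resolvent_fun {0..} T e0 z \<and>
              resolvent_fun {..<0} J (basis_vec (- 1)) z = resolvent_fun {..<0} T (basis_vec (- 1)) z)))"

section \<open>The Jacobi flow\<close>

text \<open>Entry \<open>(i, k)\<close> of \<open>U(p)\<close>; \<open>L2_set p {k..g}\<close> is the norm of the truncation \<open>d\<^sub>k p\<close>.\<close>

definition U_mat :: "nat \<Rightarrow> (nat \<Rightarrow> real) \<Rightarrow> nat \<Rightarrow> nat \<Rightarrow> real" where
  "U_mat g p i k =
     (if k = 0 then p i / L2_set p {..g}
      else (if i < k - 1 then 0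
            else if i = k - 1 then (L2_set p {k..g})\<^sup>2
            else - p (k - 1) * p i) / (L2_set p {k - 1..g} * L2_set p {k..g}))"

definition jacobi_flow :: "real list \<Rightarrow> (ell2 \<Rightarrow> ell2) \<Rightarrow> ell2 \<Rightarrow> ell2" where
  "jacobi_flow C T =
     (let U = block_diag (length C) (\<lambda>j. U_mat (length C) (p_coeffs C T j))
      in shift (- 1) \<circ> adjoint_op U \<circ> T \<circ> U \<circ> shift 1)"

end

(* Call an orthonormal family (v_n), n in Z, adapted to A if v_{-1} = e_{-1}, if v_n lies in l2_+ for
   n >= 0 and in l2_- for n < 0, and if A v_n = a(n) v_{n-1} + b(n) v_n + a(n+1) v_{n+1}.  Expanding
   the resolvent functions at infinity, the definition of J = F(A) says that A_+ and J_+ (and A_-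
   and J_-) have the same moments at their cyclic vectors, so the basis on which J acts can be
   transported isometrically to a family adapted to A.  If (v_n) is adapted to A then the
   vectors S^{-1} U_A^* v_{n+1} are adapted to the image of A under the Jacobi flow, with shifted
   coefficients, because U_A e_0 = v_0; conversely U_A S v_{n-1} goes back from the image to A, which
   covers the negative half of the orbit.  Finally a(0) is the norm of P_+ A e_{-1} and b(-1) is the
   entry of A at (-1, -1). *)

theory Submission
  imports Defs
begin

section \<open>The inner product\<close>

text \<open>Among the e_m with m < 0 only e_{-1} has an image under A with a component in l2_+, so
  the two halves of A are joined by a rank one term. This is why they can be transported separately
  and then glued: P_+ A e_{-1} = a(0) v_0 is the only bond across the cut between -1 and 0. The flow
  moves this cut by one place. U_A is block diagonal and therefore respects the cut, and the first
  column of U(p_0) is the unit vector along p_0, which is P_+ A e_{-1} up to a positive factor.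
  Hence U_A^* takes v_0 to e_0, and S^{-1} takes it on to e_{-1}, the last vector of the new
  negative half. The delicate point is thus always a single vector at the cut, and each time it is
  settled by two unit vectors having equal positive multiples; this is where a(n) > 0 enters. The
  resolvent functions are consulted once, for A itself; after that the adapted family carries the
  coefficients along the orbit.\<close>

lemma ell2_eqI: "(\<And>n. ell2_nth x n = ell2_nth y n) \<Longrightarrow> x = y"
  by (simp add: ell2_nth_inject[symmetric] fun_eq_iff)

lemma ell2_nth_simps [simp]:
  "ell2_nth 0 n = 0"
  "ell2_nth (x + y) n = ell2_nth x n + ell2_nth y n"
  "ell2_nth (x - y) n = ell2_nth x n - ell2_nth y n"
  "ell2_nth (- x) n = - ell2_nth x n"
  "ell2_nth (cscale c x) n = c * ell2_nth x n"
  "ell2_nth (r *\<^sub>R x) n = of_real r * ell2_nth x n"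
  "ell2_nth (basis_vec m) n = (if n = m then 1 else 0)"
  "ell2_nth (shift k x) n = ell2_nth x (n - k)"
  "ell2_nth (proj N x) n = (if n \<in> N then ell2_nth x n else 0)"
  by (simp_all add: zero_ell2.rep_eq plus_ell2.rep_eq minus_ell2.rep_eq uminus_ell2.rep_eq
      cscale.rep_eq scaleR_ell2_def basis_vec.rep_eq shift.rep_eq proj.rep_eq)

lemma ell2_nth_sum [simp]: "ell2_nth (sum f F) n = (\<Sum>i\<in>F. ell2_nth (f i) n)"
  by (induction F rule: infinite_finite_induct) auto

lemma cinner_commute: "cinner y x = cnj (cinner x y)"
  unfolding cinner_def by (subst infsum_cnj[symmetric]) (simp add: mult.commute)

lemma cinner_add_left: "cinner (x + y) z = cinner x z + cinner y z"
  unfolding cinner_def by (simp add: ring_distribs infsum_add cinner_summable)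

lemma cinner_cscale_left: "cinner (cscale c x) y = c * cinner x y"
  unfolding cinner_def by (simp add: mult.assoc infsum_cmult_right cinner_summable)

lemma cinner_scaleR_left: "cinner (r *\<^sub>R x) y = of_real r * cinner x y"
  by (simp add: scaleR_ell2_def cinner_cscale_left)

lemma cinner_minus_left: "cinner (- x) y = - cinner x y"
  using cinner_scaleR_left[of "-1" x y] by simp

lemma cinner_diff_left: "cinner (x - y) z = cinner x z - cinner y z"
  using cinner_add_left[of x "- y" z] by (simp add: cinner_minus_left)

lemma cinner_zero_left [simp]: "cinner 0 y = 0"
  using cinner_scaleR_left[of 0 0 y] by simp

lemma cinner_add_right: "cinner z (x + y) = cinner z x + cinner z y"
  by (simp add: cinner_commute[of z] cinner_add_left)

lemma cinner_cscale_right: "cinner y (cscale c x) = cnj c * cinner y x"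
  by (simp add: cinner_commute[of y] cinner_cscale_left)

lemma cinner_scaleR_right: "cinner y (r *\<^sub>R x) = of_real r * cinner y x"
  by (simp add: cinner_commute[of y] cinner_scaleR_left)

lemma cinner_zero_right [simp]: "cinner y 0 = 0"
  by (simp add: cinner_commute[of y])

lemma cinner_diff_right: "cinner z (x - y) = cinner z x - cinner z y"
  by (simp add: cinner_commute[of z] cinner_diff_left)

lemma cinner_basis_right: "cinner x (basis_vec n) = ell2_nth x n"
proof -
  have "cinner x (basis_vec n) = (\<Sum>\<^sub>\<infinity>m\<in>{n}. ell2_nth x m)"
    unfolding cinner_def by (rule infsum_cong_neutral) auto
  then show ?thesis by simp
qed

lemma cinner_basis_left: "cinner (basis_vec n) x = cnj (ell2_nth x n)"
  by (subst cinner_commute) (simp add: cinner_basis_right)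

lemma cinner_self: "cinner x x = of_real ((norm x)\<^sup>2)"
proof (rule complex_eqI)
  show "Re (cinner x x) = Re (of_real ((norm x)\<^sup>2))"
    by (simp add: dot_square_norm[symmetric] inner_ell2_def del: of_real_power)
  have "cinner x x = cnj (cinner x x)" by (rule cinner_commute)
  then have "Im (cinner x x) = Im (cnj (cinner x x))" by (rule arg_cong)
  then show "Im (cinner x x) = Im (of_real ((norm x)\<^sup>2))" by simp
qed

lemma cinner_self_eq_0: "cinner x x = 0 \<longleftrightarrow> x = 0"
  by (simp add: cinner_self)

lemma ell2_eq_cinnerI: "(\<And>y. cinner y u = cinner y w) \<Longrightarrow> u = w"
  using cinner_self_eq_0[of "u - w"] by (simp add: cinner_diff_right)

lemma norm_ell2_sq: "(norm x)\<^sup>2 = (\<Sum>\<^sub>\<infinity>n. (cmod (ell2_nth x n))\<^sup>2)"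
  by (simp add: dot_square_norm[symmetric] inner_ell2_self)

lemma norm_cscale [simp]: "norm (cscale c x) = cmod c * norm x"
proof -
  have "(norm (cscale c x))\<^sup>2 = (cmod c * norm x)\<^sup>2"
    by (simp add: norm_ell2_sq norm_mult power_mult_distrib infsum_cmult_right ell2_nth_summable)
  then show ?thesis by (rule power2_eq_imp_eq) auto
qed

lemma norm_eq_1_iff: "norm (x :: ell2) = 1 \<longleftrightarrow> cinner x x = 1"
proof -
  have "cinner x x = 1 \<longleftrightarrow> (norm x)\<^sup>2 = 1"
    unfolding cinner_self by (rule of_real_eq_1_iff)
  also have "\<dots> \<longleftrightarrow> norm x = 1"
    using norm_ge_zero[of x] by (auto simp: power2_eq_1_iff simp del: norm_ge_zero)
  finally show ?thesis ..
qed

text \<open>\<open>inner\<close> is the real part of \<open>cinner\<close>; a unimodular factor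
  \<open>c\<close> rotates \<open>cinner x y\<close> onto the nonnegative axis, where the real
  inequality is the complex one.\<close>

lemma cinner_Cauchy_Schwarz: "cmod (cinner x y) \<le> norm x * norm y"
proof -
  obtain c where c: "cmod c = 1" "c * cinner x y = of_real (cmod (cinner x y))"
  proof (cases "cinner x y = 0")
    case True
    show ?thesis by (rule that[of 1]) (use True in auto)
  next
    case False
    show ?thesis
    proof (rule that)
      show "cmod (cnj (cinner x y) / of_real (cmod (cinner x y))) = 1"
        using False by (simp add: norm_divide)
      show "cnj (cinner x y) / of_real (cmod (cinner x y)) * cinner x y = of_real (cmod (cinner x y))"
        using False complex_norm_square[of "cinner x y"]
        by (simp add: field_simps power2_eq_square)
    qed
  qed
  have "cmod (cinner x y) = inner (cscale c x) y"
    by (simp add: inner_ell2_def cinner_cscale_left c)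
  also have "\<dots> \<le> norm (cscale c x) * norm y" by (rule norm_cauchy_schwarz)
  finally show ?thesis using c by simp
qed

lemma bounded_linear_cinner_left: "bounded_linear (\<lambda>x. cinner x y)"
  by (rule bounded_linear_intro[where K = "norm y"])
    (simp_all add: cinner_add_left cinner_scaleR_left cinner_Cauchy_Schwarz scaleR_conv_of_real)

section \<open>Density of finitely supported sequences and completeness\<close>

lemma proj_finite: "finite F \<Longrightarrow> proj F x = (\<Sum>n\<in>F. cscale (ell2_nth x n) (basis_vec n))"
  by (rule ell2_eqI) (simp add: if_distrib cong: if_cong)

lemma finite_approximation:
  assumes "e > 0"
  obtains F where "finite F" "norm (x - proj F x) < e"
proof -
  let ?f = "\<lambda>n. (cmod (ell2_nth x n))\<^sup>2"
  have sum: "(?f has_sum (norm x)\<^sup>2) UNIV"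
    unfolding norm_ell2_sq by (rule has_sum_infsum[OF ell2_nth_summable])
  \<comment> \<open>Half of the square, because the approximation gives a weak inequality and a
    strict one is wanted.\<close>
  have "e\<^sup>2 / 2 > 0" using assms by simp
  from has_sum_finite_approximation[OF sum this]
  obtain F where F: "finite F" "dist (sum ?f F) ((norm x)\<^sup>2) \<le> e\<^sup>2 / 2"
    by blast
  have "(norm x)\<^sup>2 = (\<Sum>\<^sub>\<infinity>n. (cmod (ell2_nth (x - proj F x) n))\<^sup>2 + (cmod (ell2_nth (proj F x) n))\<^sup>2)"
    unfolding norm_ell2_sq by (rule infsum_cong) auto
  also have "\<dots> = (norm (x - proj F x))\<^sup>2 + (norm (proj F x))\<^sup>2"
    unfolding norm_ell2_sq by (rule infsum_add[OF ell2_nth_summable ell2_nth_summable])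
  also have "(norm (proj F x))\<^sup>2 = (\<Sum>\<^sub>\<infinity>n\<in>F. ?f n)"
    unfolding norm_ell2_sq by (rule infsum_cong_neutral) auto
  finally have "(norm (x - proj F x))\<^sup>2 = (norm x)\<^sup>2 - sum ?f F"
    using F(1) by simp
  also have "\<dots> \<le> dist (sum ?f F) ((norm x)\<^sup>2)"
    by (simp add: dist_real_def)
  also have "\<dots> < e\<^sup>2"
    using F(2) assms zero_less_power[of e 2] by linarith
  finally have "norm (x - proj F x) < e"
    by (rule power_less_imp_less_base) (use assms in simp)
  with F(1) show ?thesis by (rule that)
qed

text \<open>Density of the finitely supported sequences in the form used below. Since
  \<open>bounded_linear\<close> means real linearity, \<open>hom\<close> is what passes from the
  basis vectors to their complex multiples.\<close>

lemma bounded_linear_eq_0: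
  assumes f: "bounded_linear f" and hom: "\<And>c x. f (cscale c x) = c * f x"
    and basis: "\<And>n. f (basis_vec n) = (0 :: complex)"
  shows "f x = 0"
proof -
  interpret bounded_linear f by fact
  obtain K where K: "K > 0" "\<And>x. norm (f x) \<le> norm x * K"
    using pos_bounded by blast
  have "norm (f x) \<le> e" if e: "e > 0" for e :: real
  proof -
    have "e / K > 0" using e K(1) by simp
    then obtain F where F: "finite F" "norm (x - proj F x) < e / K"
      by (rule finite_approximation)
    have "f (proj F x) = (\<Sum>n\<in>F. f (cscale (ell2_nth x n) (basis_vec n)))"
      unfolding proj_finite[OF F(1)] by (rule sum)
    also have "\<dots> = 0" unfolding hom basis by simp
    finally have "f (proj F x) = 0" .
    then have "norm (f x) = norm (f (x - proj F x))" by (simp add: diff)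
    also have "\<dots> \<le> norm (x - proj F x) * K" by (rule K(2))
    also have "\<dots> \<le> e" using F(2) K(1) by (simp add: field_simps)
    finally show ?thesis .
  qed
  then have "norm (f x) \<le> 0 + e" if "e > 0" for e :: real
    using that by simp
  then have "norm (f x) \<le> 0" by (rule field_le_epsilon)
  then show ?thesis by simp
qed

text \<open>Makes the Banach fixed point theorem available for resolvent equations. The limit is
  taken coordinatewise; bounds on finite partial sums survive the limit and give both its square
  summability and convergence in norm.\<close>

instance ell2 :: complete_space
proof
  fix X :: "nat \<Rightarrow> ell2"
  assume "Cauchy X"
  have "Cauchy (\<lambda>m. ell2_nth (X m) n)" for n
    unfolding cinner_basis_right[symmetric]
    by (rule bounded_linear.Cauchy[OF bounded_linear_cinner_left \<open>Cauchy X\<close>])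
  then have "\<forall>n. \<exists>l. (\<lambda>m. ell2_nth (X m) n) \<longlonglongrightarrow> l"
    by (simp add: Cauchy_convergent_iff convergent_def)
  then obtain y where y: "\<And>n. (\<lambda>m. ell2_nth (X m) n) \<longlonglongrightarrow> y n"
    by metis
  have bound: "(\<Sum>n\<in>F. (cmod (ell2_nth (X m) n - y n))\<^sup>2) \<le> e\<^sup>2"
    if M: "\<And>k. k \<ge> M \<Longrightarrow> norm (X m - X k) \<le> e" and F: "finite F" for F m M e
  proof (rule tendsto_upperbound)
    show "(\<lambda>k. \<Sum>n\<in>F. (cmod (ell2_nth (X m) n - ell2_nth (X k) n))\<^sup>2)
        \<longlonglongrightarrow> (\<Sum>n\<in>F. (cmod (ell2_nth (X m) n - y n))\<^sup>2)"
      by (intro tendsto_intros y)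
    show "\<forall>\<^sub>F k in sequentially. (\<Sum>n\<in>F. (cmod (ell2_nth (X m) n - ell2_nth (X k) n))\<^sup>2) \<le> e\<^sup>2"
    proof (rule eventually_sequentiallyI)
      fix k assume k: "M \<le> k"
      have "(\<Sum>n\<in>F. (cmod (ell2_nth (X m - X k) n))\<^sup>2) \<le> (norm (X m - X k))\<^sup>2"
        unfolding norm_ell2_sq by (rule finite_sum_le_infsum[OF ell2_nth_summable F]) auto
      also have "\<dots> \<le> e\<^sup>2" using M[OF k] by (intro power_mono) auto
      finally show "(\<Sum>n\<in>F. (cmod (ell2_nth (X m) n - ell2_nth (X k) n))\<^sup>2) \<le> e\<^sup>2" by simp
    qed
  qed simp
  have summable: "(\<lambda>n. (cmod (ell2_nth (X m) n - y n))\<^sup>2) summable_on UNIV"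
    if "\<And>k. k \<ge> M \<Longrightarrow> norm (X m - X k) \<le> e" for m M e
    by (rule nonneg_bdd_above_summable_on)
      (use bound[OF that] in \<open>auto intro!: bdd_aboveI[where M = "e\<^sup>2"]\<close>)
  have Cauchy_le: "\<exists>M. \<forall>m\<ge>M. \<forall>k\<ge>M. norm (X m - X k) \<le> e" if e: "e > 0" for e
  proof -
    obtain M where "\<forall>m\<ge>M. \<forall>k\<ge>M. norm (X m - X k) < e"
      using CauchyD[OF \<open>Cauchy X\<close> e] by blast
    then show ?thesis by (intro exI[of _ M]) (auto intro: less_imp_le)
  qed
  obtain M where M: "\<And>k. k \<ge> M \<Longrightarrow> norm (X M - X k) \<le> 1"
    using Cauchy_le[of 1, OF zero_less_one] by blast
  \<comment> \<open>The limit \<open>y\<close> is written as \<open>X M\<close> minus the square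
    summable difference \<open>X M - y\<close>.\<close>
  have "(\<lambda>n. (cmod (ell2_nth (X M) n + - (ell2_nth (X M) n - y n)))\<^sup>2) summable_on UNIV"
  proof (rule square_summable_add[OF ell2_nth_summable])
    have "(\<lambda>n. (cmod (- (ell2_nth (X M) n - y n)))\<^sup>2) = (\<lambda>n. (cmod (ell2_nth (X M) n - y n))\<^sup>2)"
      by (simp only: norm_minus_cancel)
    then show "(\<lambda>n. (cmod (- (ell2_nth (X M) n - y n)))\<^sup>2) summable_on UNIV"
      using summable[of M M, OF M] by simp
  qed
  then have Y: "ell2_nth (Abs_ell2 y) = y"
    by (simp add: Abs_ell2_inverse)
  have "X \<longlonglongrightarrow> Abs_ell2 y"
  proof (rule LIMSEQ_I)
    fix r :: real assume "r > 0"
    then obtain M where M: "\<And>m k. m \<ge> M \<Longrightarrow> k \<ge> M \<Longrightarrow> norm (X m - X k) \<le> r / 2"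
      using Cauchy_le[of "r / 2", OF half_gt_zero] by blast
    have "norm (X m - Abs_ell2 y) < r" if m: "m \<ge> M" for m
    proof -
      have "(norm (X m - Abs_ell2 y))\<^sup>2 \<le> (r / 2)\<^sup>2"
        unfolding norm_ell2_sq
        by (rule infsum_le_finite_sums[OF ell2_nth_summable])
          (use bound[of M m "r / 2", OF M[OF m]] in \<open>simp only: ell2_nth_simps Y\<close>)
      then have "norm (X m - Abs_ell2 y) \<le> r / 2"
        using \<open>r > 0\<close> by (meson half_gt_zero less_imp_le power2_le_imp_le)
      then show ?thesis using \<open>r > 0\<close> by simp
    qed
    then show "\<exists>no. \<forall>n\<ge>no. norm (X n - Abs_ell2 y) < r" by blast
  qed
  then show "convergent X" by (rule convergentI)
qed

section \<open>Symmetric operators and compressions\<close>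

definition symmetric_op :: "(ell2 \<Rightarrow> ell2) \<Rightarrow> bool" where
  "symmetric_op T \<longleftrightarrow> (\<forall>x y. cinner (T x) y = cinner x (T y))"

text \<open>The inner projection extends the compression by zero to all of \<open>ell2\<close> (for
  linear \<open>T\<close>), so that powers and symmetry need no type for the subspace.\<close>

definition compress :: "int set \<Rightarrow> (ell2 \<Rightarrow> ell2) \<Rightarrow> ell2 \<Rightarrow> ell2" where
  "compress N T x = proj N (T (proj N x))"

lemma cscale_diff_right: "cscale c (x - y) = cscale c x - cscale c y"
  by (rule ell2_eqI) (simp add: algebra_simps)

lemma symmetric_opD: "symmetric_op T \<Longrightarrow> cinner (T x) y = cinner x (T y)"
  by (simp add: symmetric_op_def)

text \<open>Density is applied once per argument; both functionals are written with the free vector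
  in the first argument of \<open>cinner\<close>, where it is linear.\<close>

lemma symmetric_op_if_entries:
  assumes T: "bounded_op T" and entry: "\<And>m n. entry T m n = cnj (entry T n m)"
  shows "symmetric_op T"
proof -
  have lin: "bounded_linear T" and hom: "\<And>c x. T (cscale c x) = cscale c (T x)"
    using T by (auto simp: bounded_op_def)
  have 1: "cinner (T x) (basis_vec m) - cinner x (T (basis_vec m)) = 0" for x m
  proof (rule bounded_linear_eq_0[of "\<lambda>x. cinner (T x) (basis_vec m) - cinner x (T (basis_vec m))"])
    show "bounded_linear (\<lambda>x. cinner (T x) (basis_vec m) - cinner x (T (basis_vec m)))"
      by (intro bounded_linear_sub bounded_linear_cinner_left
          bounded_linear_compose[OF bounded_linear_cinner_left lin])
    show "cinner (T (basis_vec n)) (basis_vec m) - cinner (basis_vec n) (T (basis_vec m)) = 0" for n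
      using entry[of m n] by (simp add: entry_def cinner_commute[of "basis_vec n"])
  qed (simp add: hom cinner_cscale_left algebra_simps)
  have 2: "cinner y (T x) - cinner (T y) x = 0" for x y
  proof (rule bounded_linear_eq_0[of "\<lambda>y. cinner y (T x) - cinner (T y) x"])
    show "bounded_linear (\<lambda>y. cinner y (T x) - cinner (T y) x)"
      by (intro bounded_linear_sub bounded_linear_cinner_left
          bounded_linear_compose[OF bounded_linear_cinner_left lin])
    show "cinner (basis_vec n) (T x) - cinner (T (basis_vec n)) x = 0" for n
      using 1[of x n] by (simp add: cinner_commute[of "basis_vec n"] cinner_commute[of "T (basis_vec n)" x])
  qed (simp add: hom cinner_cscale_left algebra_simps)
  show ?thesis using 2 by (simp add: symmetric_op_def)
qed

lemma proj_add: "proj N (x + y) = proj N x + proj N y"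
  by (rule ell2_eqI) simp

lemma proj_scaleR: "proj N (r *\<^sub>R x) = r *\<^sub>R proj N x"
  by (rule ell2_eqI) simp

lemma proj_cscale: "proj N (cscale c x) = cscale c (proj N x)"
  by (rule ell2_eqI) simp

lemma proj_zero [simp]: "proj N 0 = 0"
  by (rule ell2_eqI) simp

lemma proj_diff: "proj N (x - y) = proj N x - proj N y"
  by (rule ell2_eqI) simp

lemma proj_idem [simp]: "proj N (proj N x) = proj N x"
  by (rule ell2_eqI) simp

lemma proj_basis_vec [simp]: "proj N (basis_vec n) = (if n \<in> N then basis_vec n else 0)"
  by (rule ell2_eqI) simp

lemma proj_eq_self_iff: "proj N x = x \<longleftrightarrow> (\<forall>n. n \<notin> N \<longrightarrow> ell2_nth x n = 0)"
proof
  assume "proj N x = x"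
  then have "ell2_nth (proj N x) n = ell2_nth x n" for n by simp
  then show "\<forall>n. n \<notin> N \<longrightarrow> ell2_nth x n = 0" by (metis ell2_nth_simps(9))
qed (auto intro: ell2_eqI)

lemma mem_range_proj_iff: "x \<in> range (proj N) \<longleftrightarrow> proj N x = x"
  by (metis proj_idem rangeE rangeI)

lemma cinner_proj: "cinner (proj N x) y = cinner x (proj N y)"
  unfolding cinner_def by (rule infsum_cong) simp

lemma norm_proj_le: "norm (proj N x) \<le> norm x"
proof -
  have "(norm (proj N x))\<^sup>2 \<le> (norm x)\<^sup>2"
    unfolding norm_ell2_sq by (rule infsum_mono[OF ell2_nth_summable ell2_nth_summable]) auto
  then show ?thesis by (rule power2_le_imp_le) simp
qed

lemma bounded_op_proj: "bounded_op (proj N)"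
  unfolding bounded_op_def
  by (auto intro!: bounded_linear_intro[where K = 1] simp: proj_add proj_scaleR proj_cscale norm_proj_le)

lemma bounded_op_compress:
  assumes "bounded_op T"
  shows "bounded_op (compress N T)"
proof -
  have "bounded_linear (\<lambda>x. proj N (T (proj N x)))"
    using assms bounded_op_proj[of N]
    by (auto simp: bounded_op_def intro!: bounded_linear_compose[of "proj N"] bounded_linear_compose[of T])
  then show ?thesis
    using assms by (simp add: bounded_op_def compress_def[abs_def] proj_cscale)
qed

lemma symmetric_op_compress: "symmetric_op T \<Longrightarrow> symmetric_op (compress N T)"
  by (simp add: symmetric_op_def compress_def cinner_proj)

lemma bounded_op_funpow:
  assumes "bounded_op T"
  shows "bounded_op (T ^^ k)"
proof (induction k)
  case 0
  then show ?case by (simp add: bounded_op_def id_def[symmetric] bounded_linear_ident[folded id_def])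
next
  case (Suc k)
  with assms show ?case
    by (auto simp: bounded_op_def o_def intro!: bounded_linear_compose[of T])
qed

section \<open>Moments from resolvents\<close>

text \<open>For R = \<open>compress N T\<close> the equation (R - it) x = v says that x is a fixed
  point of x -> (R x - v) / (it), a contraction with factor K / t. The same equation gives t |x|
  \<le> K |x| + |v|, hence the decay in t.\<close>

lemma resolvent_at_imaginary:
  assumes T: "bounded_op T" and v: "proj N v = v"
    and K: "\<And>x. norm (compress N T x) \<le> K * norm x" "K \<ge> 0" and t: "t > K"
  obtains x where "compress N T x = cscale (\<i> * of_real t) x + v"
    "resolvent_fun N T v (\<i> * of_real t) = cinner x v" "norm x \<le> norm v / (t - K)"
proof -
  let ?R = "compress N T" and ?z = "\<i> * complex_of_real t"
  let ?h = "\<lambda>x. cscale (1 / ?z) (?R x - v)"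
  have t0: "t > 0" using t K by simp
  then have z: "?z \<noteq> 0" "cmod ?z = t" by (simp_all add: norm_mult)
  have fix_iff: "?h x = x \<longleftrightarrow> ?R x = cscale ?z x + v" for x
  proof
    assume "?h x = x"
    then have "cscale ?z x = cscale ?z (?h x)" by simp
    also have "\<dots> = ?R x - v" using z by (intro ell2_eqI) simp
    finally show "?R x = cscale ?z x + v" by simp
  next
    assume "?R x = cscale ?z x + v"
    then show "?h x = x" using z by (intro ell2_eqI) simp
  qed
  have linear_R: "?R x - ?R y = ?R (x - y)" for x y
    using bounded_op_compress[OF T, of N]
    by (simp add: bounded_op_def linear_diff bounded_linear.linear)
  have "\<exists>!x. ?h x = x"
  proof (rule banach_fix_type)
    show "0 \<le> K / t" "K / t < 1" using t t0 K by auto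
    show "\<forall>x y. dist (?h x) (?h y) \<le> K / t * dist x y"
    proof (intro allI)
      fix x y
      have "?h x - ?h y = cscale (1 / ?z) (?R (x - y))"
        unfolding linear_R[symmetric] by (intro ell2_eqI) (simp add: algebra_simps)
      then have "dist (?h x) (?h y) = norm (?R (x - y)) / t"
        using z t0 by (simp add: dist_norm norm_divide norm_mult)
      also have "\<dots> \<le> K * norm (x - y) / t"
        using t0 K by (intro divide_right_mono) auto
      finally show "dist (?h x) (?h y) \<le> K / t * dist x y" by (simp add: dist_norm)
    qed
  qed
  then obtain x where x: "?h x = x" and unique: "\<And>y. ?h y = y \<Longrightarrow> y = x" by blast
  have Rx: "?R x = cscale ?z x + v" using x fix_iff by blast
  \<comment> \<open>The fixed point lies in the subspace because \<open>?h\<close> maps every fixed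
    vector of \<open>proj N\<close> (and indeed every vector) as soon as its image is a fixed point:
    projecting \<open>?h x = x\<close> only touches \<open>v\<close> and
    \<open>compress N T x\<close>, both in the range, and \<open>x\<close> itself.\<close>
  have range: "proj N x = x"
  proof -
    have "proj N (?h x) = ?h x" by (simp add: proj_cscale proj_diff v compress_def)
    then show ?thesis using x by simp
  qed
  \<comment> \<open>\<open>inv_into\<close> returns some preimage in the range; injectivity
    identifies it with the \<open>x\<close> just found.\<close>
  have inj: "inj_on (\<lambda>x. proj N (T x) - cscale ?z x) (range (proj N))"
  proof (rule inj_onI)
    fix y y' assume y: "y \<in> range (proj N)" and y': "y' \<in> range (proj N)"
      and eq: "proj N (T y) - cscale ?z y = proj N (T y') - cscale ?z y'"
    have "?R y = proj N (T y)" "?R y' = proj N (T y')"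
      using y y' by (simp_all add: compress_def mem_range_proj_iff)
    then have "?R y - ?R y' = cscale ?z y - cscale ?z y'"
      using eq by (simp add: algebra_simps)
    then have "?R (y - y') = cscale ?z (y - y')"
      unfolding linear_R cscale_diff_right .
    then have "norm (?R (y - y')) = t * norm (y - y')"
      using z by simp
    then have "t * norm (y - y') \<le> K * norm (y - y')"
      using K(1)[of "y - y'"] by simp
    then have "norm (y - y') = 0" using t by (meson mult_le_cancel_right not_le norm_ge_zero order_antisym)
    then show "y = y'" by simp
  qed
  have "proj N (T x) - cscale ?z x = v"
    using Rx range by (simp add: compress_def)
  then have "inv_into (range (proj N)) (\<lambda>x. proj N (T x) - cscale ?z x) v = x"
    using inj range by (intro inv_into_f_eq) (auto simp: mem_range_proj_iff)
  then have res: "resolvent_fun N T v ?z = cinner x v" by (simp add: resolvent_fun_def)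
  have "t * norm x = norm (cscale ?z x)" using z by simp
  also have "cscale ?z x = ?R x - v" using Rx by simp
  also have "norm (?R x - v) \<le> K * norm x + norm v"
    using norm_triangle_ineq4[of "?R x" v] K(1)[of x] by linarith
  finally have "norm x \<le> norm v / (t - K)" using t by (simp add: field_simps)
  with Rx res that show ?thesis by blast
qed

lemma resolvent_family:
  assumes T: "bounded_op T" and v: "proj N v = v"
  obtains K x where
    "\<And>t. t > K \<Longrightarrow> compress N T (x t) = cscale (\<i> * of_real t) (x t) + v"
    "\<And>t. t > K \<Longrightarrow> resolvent_fun N T v (\<i> * of_real t) = cinner (x t) v"
    "(x \<longlongrightarrow> 0) at_top" "K \<ge> 0"
proof -
  obtain K where K: "K \<ge> 0" "\<And>x. norm (compress N T x) \<le> norm x * K"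
    using bounded_op_compress[OF T, of N] bounded_linear.nonneg_bounded
    unfolding bounded_op_def by blast
  have "\<exists>x. t > K \<longrightarrow> compress N T x = cscale (\<i> * of_real t) x + v \<and>
      resolvent_fun N T v (\<i> * of_real t) = cinner x v \<and> norm x \<le> norm v / (t - K)" for t
    using resolvent_at_imaginary[OF T v, of K t] K by (metis mult.commute)
  then obtain x where x: "\<And>t. t > K \<Longrightarrow> compress N T (x t) = cscale (\<i> * of_real t) (x t) + v"
    "\<And>t. t > K \<Longrightarrow> resolvent_fun N T v (\<i> * of_real t) = cinner (x t) v"
    "\<And>t. t > K \<Longrightarrow> norm (x t) \<le> norm v / (t - K)"
    by metis
  have "(x \<longlongrightarrow> 0) at_top"
  proof (rule Lim_null_comparison)
    have "filterlim (\<lambda>t. - K + t) at_top at_top"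
      by (rule filterlim_tendsto_add_at_top[OF tendsto_const filterlim_ident])
    then have "filterlim (\<lambda>t. t - K) at_infinity at_top"
      by (simp add: filterlim_at_top_imp_at_infinity)
    then show "((\<lambda>t. norm v / (t - K)) \<longlongrightarrow> 0) at_top"
      by (rule tendsto_divide_0[OF tendsto_const])
    show "\<forall>\<^sub>F t in at_top. norm (x t) \<le> norm v / (t - K)"
      using eventually_gt_at_top[of K] by eventually_elim (rule x)
  qed
  with x K(1) that show ?thesis by blast
qed

text \<open>With \<open>(R - it) x\<^sub>t = v\<close> one has \<open>it \<langle>R\<^sup>k x\<^sub>t, v\<rangle> \<longlongrightarrow> -\<langle>R\<^sup>k v, v\<rangle>\<close> and
  \<open>\<langle>R\<^sup>k\<^sup>+\<^sup>1 x\<^sub>t, v\<rangle> = it \<langle>R\<^sup>k x\<^sub>t, v\<rangle> + \<langle>R\<^sup>k v, v\<rangle>\<close>: the first relation yields the \<open>k\<close>-th moment,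
  and the second allows to go on to \<open>k + 1\<close>.\<close>

lemma moments_eq_if_resolvents_eq:
  assumes T: "bounded_op T" "proj N v = v" and T': "bounded_op T'" "proj N' v' = v'"
    and eq: "\<And>z. Im z \<noteq> 0 \<Longrightarrow> resolvent_fun N T v z = resolvent_fun N' T' v' z"
  shows "cinner ((compress N T ^^ k) v) v = cinner ((compress N' T' ^^ k) v') v'"
proof -
  let ?R = "compress N T" and ?R' = "compress N' T'"
  obtain K x where K: "K \<ge> 0" and
    x: "\<And>t. t > K \<Longrightarrow> ?R (x t) = cscale (\<i> * of_real t) (x t) + v"
    "\<And>t. t > K \<Longrightarrow> resolvent_fun N T v (\<i> * of_real t) = cinner (x t) v" "(x \<longlongrightarrow> 0) at_top"
    using resolvent_family[OF T] by metis
  obtain K' x' where K': "K' \<ge> 0" and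
    x': "\<And>t. t > K' \<Longrightarrow> ?R' (x' t) = cscale (\<i> * of_real t) (x' t) + v'"
    "\<And>t. t > K' \<Longrightarrow> resolvent_fun N' T' v' (\<i> * of_real t) = cinner (x' t) v'" "(x' \<longlongrightarrow> 0) at_top"
    using resolvent_family[OF T'] by metis
  have lim: "((\<lambda>t. \<i> * of_real t * cinner ((R ^^ k) (x t)) v) \<longlongrightarrow> - cinner ((R ^^ k) v) v) at_top"
    and step: "t > K \<Longrightarrow> cinner ((R ^^ Suc k) (x t)) v =
      \<i> * of_real t * cinner ((R ^^ k) (x t)) v + cinner ((R ^^ k) v) v"
    if R: "bounded_op R" and x: "\<And>t. t > K \<Longrightarrow> R (x t) = cscale (\<i> * of_real t) (x t) + v"
      "(x \<longlongrightarrow> 0) at_top"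
    for R K x v k t
  proof -
    have lin: "bounded_linear R" "bounded_linear (R ^^ k)"
      and hom: "\<And>c x. (R ^^ k) (cscale c x) = cscale c ((R ^^ k) x)"
      using R bounded_op_funpow[OF R, of k] by (auto simp: bounded_op_def)
    interpret Rk: bounded_linear "\<lambda>x. cinner ((R ^^ k) x) v"
      by (intro bounded_linear_compose[OF bounded_linear_cinner_left lin(2)])
    show 1: "cinner ((R ^^ Suc k) (x t)) v =
        \<i> * of_real t * cinner ((R ^^ k) (x t)) v + cinner ((R ^^ k) v) v" if "t > K" for t
      unfolding funpow_Suc_right o_apply x(1)[OF that]
      by (simp only: Rk.add hom cinner_cscale_left)
    have "((\<lambda>t. R (x t)) \<longlongrightarrow> 0) at_top"
      using bounded_linear.tendsto[OF lin(1) x(2)] bounded_linear.linear[OF lin(1)]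
      by (simp add: linear_0)
    then have "((\<lambda>t. cinner ((R ^^ k) (R (x t))) v) \<longlongrightarrow> 0) at_top"
      using Rk.tendsto[of "\<lambda>t. R (x t)" 0 at_top] by (simp add: Rk.zero)
    then have "((\<lambda>t. cinner ((R ^^ Suc k) (x t)) v - cinner ((R ^^ k) v) v)
        \<longlongrightarrow> 0 - cinner ((R ^^ k) v) v) at_top"
      unfolding funpow_Suc_right o_apply by (intro tendsto_intros)
    then show "((\<lambda>t. \<i> * of_real t * cinner ((R ^^ k) (x t)) v) \<longlongrightarrow> - cinner ((R ^^ k) v) v) at_top"
    proof (rule Lim_transform_eventually[OF _ eventually_mono[OF eventually_gt_at_top[of K]], THEN back_subst[of "\<lambda>l. (_ \<longlongrightarrow> l) at_top"]])
      show "cinner ((R ^^ Suc k) (x t)) v - cinner ((R ^^ k) v) v = \<i> * of_real t * cinner ((R ^^ k) (x t)) v"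
        if "K < t" for t
        using 1[OF that] by simp
    qed simp
  qed
  note R = bounded_op_compress[OF T(1), of N] and R' = bounded_op_compress[OF T'(1), of N']
  have moment: "cinner ((?R ^^ k) v) v = cinner ((?R' ^^ k) v') v'"
    if "\<And>t. t > max K K' \<Longrightarrow> cinner ((?R ^^ k) (x t)) v = cinner ((?R' ^^ k) (x' t)) v'" for k
  proof -
    have "((\<lambda>t. \<i> * of_real t * cinner ((?R ^^ k) (x t)) v) \<longlongrightarrow> - cinner ((?R' ^^ k) v') v') at_top"
      by (rule Lim_transform_eventually[OF lim[OF R' x'(1,3)] eventually_mono[OF eventually_gt_at_top[of "max K K'"]]])
        (simp_all add: that)
    from tendsto_unique[OF _ this lim[OF R x(1,3)]] show ?thesis by simp
  qed
  \<comment> \<open>The passage from \<open>k\<close> to \<open>k + 1\<close> uses the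
    \<open>k\<close>-th moment, a limit over all large \<open>t\<close>; the induction hypothesis is
    therefore kept general in \<open>t\<close>.\<close>
  have "cinner ((?R ^^ k) (x t)) v = cinner ((?R' ^^ k) (x' t)) v'" if t: "t > max K K'" for t
    using t
  proof (induction k arbitrary: t)
    case 0
    then have "t > K" "t > K'" "t \<noteq> 0" using K by auto
    then show ?case using eq[of "\<i> * of_real t"] x(2) x'(2) by simp
  next
    case (Suc k)
    then have "t > K" "t > K'" by auto
    with step[OF R x(1,3), where t = t and k = k] step[OF R' x'(1,3), where t = t and k = k] Suc.IH[OF Suc.prems] moment[OF Suc.IH]
    show ?case by simp
  qed
  then show ?thesis by (rule moment)
qed

section \<open>Transporting a Jacobi basis\<close>

text \<open>By symmetry the inner product of R^k v and R^l v is the moment of order k + l, so equal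
  moments make R'^k u_0 -> R^k v an isometry of Krylov spaces intertwining R' and R. The recursion,
  having nonzero \<open>\<alpha>\<close>, places every \<open>u n\<close> in the Krylov space of
  \<open>u 0\<close>, and \<open>w n\<close> is its image. The invariant subspace \<open>V\<close>
  keeps the images on the right half-line. A graph is used for the isometry, so that its being
  single valued becomes a consequence of preserving inner products.\<close>

lemma jacobi_transport:
  fixes R R' :: "ell2 \<Rightarrow> ell2" and u :: "nat \<Rightarrow> ell2" and \<alpha> \<beta> :: "nat \<Rightarrow> real"
  assumes R: "bounded_op R" "symmetric_op R" and R': "bounded_op R'" "symmetric_op R'"
    and moments: "\<And>k. cinner ((R ^^ k) v) v = cinner ((R' ^^ k) (u 0)) (u 0)"
    and rec: "\<And>n. R' (u n) = \<alpha> (Suc n) *\<^sub>R u (Suc n) + \<beta> n *\<^sub>R u n +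
        (if n = 0 then 0 else \<alpha> n *\<^sub>R u (n - 1))"
    and \<alpha>: "\<And>n. \<alpha> (Suc n) \<noteq> 0"
    and V: "subspace V" "v \<in> V" "\<And>x. x \<in> V \<Longrightarrow> R x \<in> V"
  obtains w where "w 0 = v" "\<And>n. w n \<in> V" "\<And>m n. cinner (w m) (w n) = cinner (u m) (u n)"
    "\<And>n. R (w n) = \<alpha> (Suc n) *\<^sub>R w (Suc n) + \<beta> n *\<^sub>R w n +
        (if n = 0 then 0 else \<alpha> n *\<^sub>R w (n - 1))"
proof -
  \<comment> \<open>\<open>G\<close> is the graph of the isometry intertwining \<open>R'\<close> and \<open>R\<close>.\<close>
  define G where "G = span (range (\<lambda>k. ((R ^^ k) v, (R' ^^ k) (u 0))))"
  have linR: "linear R" "linear R'"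
    using R R' by (auto simp: bounded_op_def bounded_linear.linear)
  have G_V: "fst p \<in> V" if "p \<in> G" for p
    using that unfolding G_def
  proof (rule span_induct)
    show "subspace {p. fst p \<in> V}"
      using V(1) by (auto simp: subspace_def)
    have "(R ^^ k) v \<in> V" for k by (induction k) (auto intro: V)
    then show "fst p \<in> V" if "p \<in> range (\<lambda>k. ((R ^^ k) v, (R' ^^ k) (u 0)))" for p
      using that by auto
  qed
  have G_step: "(R (fst p), R' (snd p)) \<in> G" if "p \<in> G" for p
    using that unfolding G_def
  proof (rule span_induct)
    show "subspace {p. (R (fst p), R' (snd p)) \<in> span (range (\<lambda>k. ((R ^^ k) v, (R' ^^ k) (u 0))))}"
      using linR
      by (auto simp: subspace_def linear_0 linear_add linear_scale zero_prod_def[symmetric] span_zero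
          simp flip: add_Pair scaleR_Pair intro: span_add span_scale)
    show "(R (fst p), R' (snd p)) \<in> span (range (\<lambda>k. ((R ^^ k) v, (R' ^^ k) (u 0))))"
      if p: "p \<in> range (\<lambda>k. ((R ^^ k) v, (R' ^^ k) (u 0)))" for p
    proof -
      obtain k where "p = ((R ^^ k) v, (R' ^^ k) (u 0))" using p by blast
      then show ?thesis by (auto intro!: span_base range_eqI[of _ _ "Suc k"])
    qed
  qed
  \<comment> \<open>Moves all powers to one side, turning Gram matrix entries into moments.\<close>
  have pow_shift: "cinner ((S ^^ k) x) ((S ^^ l) y) = cinner ((S ^^ (l + k)) x) y"
    if "symmetric_op S" for S k l x y
    by (induction l arbitrary: y) (simp_all add: funpow_swap1 symmetric_opD[OF that, symmetric])
  have G_inner: "cinner (fst p) (fst q) = cinner (snd p) (snd q)" if "p \<in> G" "q \<in> G" for p q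
    using that(1) unfolding G_def
  proof (rule span_induct)
    show "subspace {p. cinner (fst p) (fst q) = cinner (snd p) (snd q)}"
      by (auto simp: subspace_def cinner_add_left cinner_scaleR_left)
    fix p assume "p \<in> range (\<lambda>k. ((R ^^ k) v, (R' ^^ k) (u 0)))"
    then obtain k where k: "p = ((R ^^ k) v, (R' ^^ k) (u 0))" by blast
    show "cinner (fst p) (fst q) = cinner (snd p) (snd q)"
      using that(2) unfolding G_def
    proof (rule span_induct)
      show "subspace {q. cinner (fst p) (fst q) = cinner (snd p) (snd q)}"
        by (auto simp: subspace_def cinner_add_right cinner_scaleR_right)
      fix q assume "q \<in> range (\<lambda>k. ((R ^^ k) v, (R' ^^ k) (u 0)))"
      then show "cinner (fst p) (fst q) = cinner (snd p) (snd q)"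
        using k moments by (auto simp: pow_shift R R')
    qed
  qed
  have G_unique: "x = 0" if "(x, 0) \<in> G" for x
    using G_inner[OF that that] by (simp add: cinner_self_eq_0)
  have G_lin: "(x + y, x' + y') \<in> G" "(x - y, x' - y') \<in> G" "(r *\<^sub>R x, r *\<^sub>R x') \<in> G"
    if "(x, x') \<in> G" "(y, y') \<in> G" for x x' y y' r
    using span_add[OF that[unfolded G_def]] span_diff[OF that[unfolded G_def]]
      span_scale[OF that(1)[unfolded G_def], of r] by (simp_all add: G_def)
  have G_0: "(0, 0) \<in> G" unfolding G_def zero_prod_def[symmetric] by (rule span_zero)
  have start: "(v, u 0) \<in> G" unfolding G_def by (rule span_base) (rule range_eqI[of _ _ 0], simp)
  have "\<exists>x. (x, u n) \<in> G" for n
  proof (induction n rule: less_induct)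
    case (less n)
    show ?case
    proof (cases n)
      case 0
      then show ?thesis using start by blast
    next
      case (Suc m)
      obtain x where x: "(x, u m) \<in> G" using less[of m] Suc by auto
      obtain y where y: "(y, if m = 0 then 0 else \<alpha> m *\<^sub>R u (m - 1)) \<in> G"
      proof (cases "m = 0")
        case False
        then have "m - 1 < n" using Suc by simp
        then obtain y where "(y, u (m - 1)) \<in> G" using less by blast
        then show ?thesis using that[of "\<alpha> m *\<^sub>R y"] False G_lin(3) by auto
      qed (use G_0 that in auto)
      \<comment> \<open>The recursion solved for its leading term; each ingredient on the right
        already has a partner in \<open>G\<close>.\<close>
      have "u n = (1 / \<alpha> n) *\<^sub>R (R' (u m) - \<beta> m *\<^sub>R u m - (if m = 0 then 0 else \<alpha> m *\<^sub>R u (m - 1)))"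
        using \<alpha>[of m] unfolding rec Suc by simp
      moreover have "((1 / \<alpha> n) *\<^sub>R (R x - \<beta> m *\<^sub>R x - y),
          (1 / \<alpha> n) *\<^sub>R (R' (u m) - \<beta> m *\<^sub>R u m - (if m = 0 then 0 else \<alpha> m *\<^sub>R u (m - 1)))) \<in> G"
        using G_step[OF x] by (intro G_lin x y) (simp_all add: G_0)
      ultimately show ?thesis by metis
    qed
  qed
  then obtain w where w: "\<And>n. (w n, u n) \<in> G" by metis
  show thesis
  proof (rule that)
    show "w 0 = v"
      using G_unique[of "w 0 - v"] G_lin(2)[OF w[of 0] start] by simp
    show "w n \<in> V" for n using G_V[OF w] by simp
    show "cinner (w m) (w n) = cinner (u m) (u n)" for m n using G_inner[OF w w] by simp
    fix n
    let ?r = "\<lambda>u. \<alpha> (Suc n) *\<^sub>R u (Suc n) + \<beta> n *\<^sub>R u n + (if n = 0 then 0 else \<alpha> n *\<^sub>R u (n - 1))"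
    have "(if n = 0 then 0 else \<alpha> n *\<^sub>R w (n - 1), if n = 0 then 0 else \<alpha> n *\<^sub>R u (n - 1)) \<in> G"
      using G_0 G_lin(3)[OF w w] by simp
    then have "(?r w, ?r u) \<in> G"
      by (intro G_lin w)
    from G_lin(2)[OF G_step[OF w[of n]] this]
    have "R (w n) - ?r w = 0" by (intro G_unique) (simp add: rec)
    then show "R (w n) = ?r w" by simp
  qed
qed

text \<open>The family is required to be orthonormal; completeness is not part of the notion. No
  value is prescribed for \<open>v 0\<close>: when \<open>a 0 > 0\<close>, the recursion at -1
  forces it to be the normalised P_+ T e_{-1}.\<close>

definition adapted_basis ::
    "(ell2 \<Rightarrow> ell2) \<Rightarrow> (int \<Rightarrow> real) \<Rightarrow> (int \<Rightarrow> real) \<Rightarrow> (int \<Rightarrow> ell2) \<Rightarrow> bool" where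
  "adapted_basis T a b v \<longleftrightarrow> v (- 1) = basis_vec (- 1) \<and>
     (\<forall>n\<ge>0. proj {0..} (v n) = v n) \<and> (\<forall>n<0. proj {..<0} (v n) = v n) \<and>
     (\<forall>m n. cinner (v m) (v n) = (if m = n then 1 else 0)) \<and>
     (\<forall>n. T (v n) = a n *\<^sub>R v (n - 1) + b n *\<^sub>R v n + a (n + 1) *\<^sub>R v (n + 1))"

lemma adapted_basisD:
  assumes "adapted_basis T a b v"
  shows "v (- 1) = basis_vec (- 1)" "n \<ge> 0 \<Longrightarrow> proj {0..} (v n) = v n"
    "n < 0 \<Longrightarrow> proj {..<0} (v n) = v n" "cinner (v m) (v n) = (if m = n then 1 else 0)"
    "T (v n) = a n *\<^sub>R v (n - 1) + b n *\<^sub>R v n + a (n + 1) *\<^sub>R v (n + 1)"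
  using assms by (auto simp: adapted_basis_def)

section \<open>The coupling between the two half-lines and the gluing across it\<close>

lemma proj_split: "x = proj {0..} x + proj {..<0} x"
  by (rule ell2_eqI) simp

lemma proj_disjoint: "proj N x = x \<Longrightarrow> N \<inter> M = {} \<Longrightarrow> proj M x = 0"
  by (rule ell2_eqI) (auto simp: proj_eq_self_iff)

text \<open>The coordinate of T x at m < 0 is the inner product of x with P_+ T e_m, which vanishes
  unless m = -1.\<close>

lemma coupling_from_plus:
  assumes T: "symmetric_op T" "\<And>m. m < - 1 \<Longrightarrow> proj {0..} (T (basis_vec m)) = 0"
    and x: "proj {0..} x = x"
  shows "proj {..<0} (T x) = cscale (cinner x (proj {0..} (T (basis_vec (- 1))))) (basis_vec (- 1))"
proof (rule ell2_eqI)
  fix m :: int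
  have "ell2_nth (T x) m = cinner x (proj {0..} (T (basis_vec m)))"
    using x by (simp add: cinner_basis_right[symmetric] symmetric_opD[OF T(1)] cinner_proj[symmetric])
  then show "ell2_nth (proj {..<0} (T x)) m =
      ell2_nth (cscale (cinner x (proj {0..} (T (basis_vec (- 1))))) (basis_vec (- 1))) m"
    using T(2)[of m] by (cases m "- 1 :: int" rule: linorder_cases) auto
qed

text \<open>The adjoint of the preceding rank one formula, obtained by testing against
  \<open>basis_vec n\<close> for n \<ge> 0.\<close>

lemma coupling_from_minus:
  assumes T: "symmetric_op T" "\<And>m. m < - 1 \<Longrightarrow> proj {0..} (T (basis_vec m)) = 0"
    and x: "proj {..<0} x = x"
  shows "proj {0..} (T x) = cscale (ell2_nth x (- 1)) (proj {0..} (T (basis_vec (- 1))))"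
    (is "_ = cscale _ ?w")
proof (rule ell2_eqI)
  fix n :: int
  show "ell2_nth (proj {0..} (T x)) n = ell2_nth (cscale (ell2_nth x (- 1)) ?w) n"
  proof (cases "n \<ge> 0")
    case True
    have "ell2_nth (T x) n = cinner x (proj {..<0} (T (basis_vec n)))"
      using x by (simp add: cinner_basis_right[symmetric] symmetric_opD[OF T(1)] cinner_proj[symmetric])
    also have "\<dots> = cinner x (cscale (cinner (basis_vec n) ?w) (basis_vec (- 1)))"
      by (subst coupling_from_plus[OF T]) (use True in auto)
    finally show ?thesis using True
      by (simp add: cinner_cscale_right cinner_basis_right cinner_basis_left mult.commute)
  qed simp
qed

lemma symmetric_op_jacobi:
  assumes "jacobi_matrix J a b"
  shows "symmetric_op J"
proof (rule symmetric_op_if_entries)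
  show "bounded_op J" using assms by (simp add: jacobi_matrix_def)
  have J: "J (basis_vec n) = a n *\<^sub>R basis_vec (n - 1) + b n *\<^sub>R basis_vec n + a (n + 1) *\<^sub>R basis_vec (n + 1)" for n
    using assms by (simp add: jacobi_matrix_def)
  show "entry J m n = cnj (entry J n m)" for m n
    by (auto simp: entry_def cinner_basis_right J)
qed

text \<open>Each half of \<open>J\<close> is transported on its own, starting from \<open>e0\<close>
  and from e_{-1}. The recursions fit together at the cut because the coupling of \<open>T\<close>
  joins exactly these two starting vectors, with the same coefficient a(0) as in
  \<open>J\<close>.\<close>

lemma adapted_basis_exists:
  assumes T: "bounded_op T" "symmetric_op T" "\<And>m. m < - 1 \<Longrightarrow> proj {0..} (T (basis_vec m)) = 0"
    and J: "jacobi_matrix J a b"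
    and e0: "proj {0..} (T (basis_vec (- 1))) = a 0 *\<^sub>R e0"
    and plus: "\<And>z. Im z \<noteq> 0 \<Longrightarrow> resolvent_fun {0..} T e0 z = resolvent_fun {0..} J (basis_vec 0) z"
    and minus: "\<And>z. Im z \<noteq> 0 \<Longrightarrow>
      resolvent_fun {..<0} T (basis_vec (- 1)) z = resolvent_fun {..<0} J (basis_vec (- 1)) z"
  shows "\<exists>v. adapted_basis T a b v"
proof -
  have a: "a n > 0" and Jop: "bounded_op J"
    and Je: "J (basis_vec n) = a n *\<^sub>R basis_vec (n - 1) + b n *\<^sub>R basis_vec n + a (n + 1) *\<^sub>R basis_vec (n + 1)" for n
    using J by (auto simp: jacobi_matrix_def)
  have Jsym: "symmetric_op J" by (rule symmetric_op_jacobi[OF J])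
  have "e0 = (1 / a 0) *\<^sub>R proj {0..} (T (basis_vec (- 1)))"
    unfolding e0 using a[of 0] by simp
  then have e0_range: "proj {0..} e0 = e0" by (metis proj_idem proj_scaleR)
  have sub: "subspace {x. proj N x = x}" for N
    by (auto simp: subspace_def proj_add proj_scaleR)
  have moments_plus: "cinner ((compress {0..} T ^^ k) e0) e0 =
      cinner ((compress {0..} J ^^ k) (basis_vec (int 0))) (basis_vec (int 0))" for k
    using moments_eq_if_resolvents_eq[OF T(1) e0_range Jop _ plus] by simp
  have moments_minus: "cinner ((compress {..<0} T ^^ k) (basis_vec (- 1))) (basis_vec (- 1)) =
      cinner ((compress {..<0} J ^^ k) (basis_vec (- 1 - int 0))) (basis_vec (- 1 - int 0))" for k
    using moments_eq_if_resolvents_eq[OF T(1) _ Jop _ minus] by simp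
  have rec_plus: "compress {0..} J (basis_vec (int n)) =
      a (int (Suc n)) *\<^sub>R basis_vec (int (Suc n)) + b (int n) *\<^sub>R basis_vec (int n) +
        (if n = 0 then 0 else a (int n) *\<^sub>R basis_vec (int (n - 1)))" for n
    by (cases n) (simp_all add: compress_def Je proj_add proj_scaleR algebra_simps)
  \<comment> \<open>The negative half-line is read backwards: step \<open>n\<close> stands for the
    index -1 - n, and the coefficient joining steps n - 1 and n is a(-n).\<close>
  have rec_minus: "compress {..<0} J (basis_vec (- 1 - int n)) =
      a (- int (Suc n)) *\<^sub>R basis_vec (- 1 - int (Suc n)) + b (- 1 - int n) *\<^sub>R basis_vec (- 1 - int n) +
        (if n = 0 then 0 else a (- int n) *\<^sub>R basis_vec (- 1 - int (n - 1)))" for n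
    by (cases n) (simp_all add: compress_def Je proj_add proj_scaleR algebra_simps)
  have inv: "compress N T x \<in> {x. proj N x = x}" for N x by (simp add: compress_def)
  obtain wp where wp: "wp 0 = e0" "\<And>n. proj {0..} (wp n) = wp n"
    "\<And>m n. cinner (wp m) (wp n) = cinner (basis_vec (int m)) (basis_vec (int n))"
    "\<And>n. compress {0..} T (wp n) = a (int (Suc n)) *\<^sub>R wp (Suc n) + b (int n) *\<^sub>R wp n +
        (if n = 0 then 0 else a (int n) *\<^sub>R wp (n - 1))"
    by (rule jacobi_transport[OF bounded_op_compress[OF T(1)] symmetric_op_compress[OF T(2)]
        bounded_op_compress[OF Jop] symmetric_op_compress[OF Jsym] moments_plus rec_plus _ sub[of "{0..}"]])
      (use a inv e0_range in \<open>auto simp: less_imp_neq[symmetric]\<close>)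
  obtain wm where wm: "wm 0 = basis_vec (- 1)" "\<And>n. proj {..<0} (wm n) = wm n"
    "\<And>m n. cinner (wm m) (wm n) = cinner (basis_vec (- 1 - int m)) (basis_vec (- 1 - int n))"
    "\<And>n. compress {..<0} T (wm n) = a (- int (Suc n)) *\<^sub>R wm (Suc n) + b (- 1 - int n) *\<^sub>R wm n +
        (if n = 0 then 0 else a (- int n) *\<^sub>R wm (n - 1))"
    by (rule jacobi_transport[OF bounded_op_compress[OF T(1)] symmetric_op_compress[OF T(2)]
        bounded_op_compress[OF Jop] symmetric_op_compress[OF Jsym] moments_minus rec_minus _ sub[of "{..<0}"]])
      (use a inv in \<open>auto simp: less_imp_neq[symmetric]\<close>)
  define v where "v n = (if n \<ge> 0 then wp (nat n) else wm (nat (- 1 - n)))" for n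
  have v_plus [simp]: "v (int k) = wp k" and v_minus [simp]: "v (- 1 - int k) = wm k" for k
    by (simp_all add: v_def)
  have orth: "cinner (wp m) (wm n) = 0" for m n
  proof -
    have "cinner (wp m) (wm n) = cinner (wp m) (proj {0..} (wm n))"
      by (subst wp(2)[symmetric]) (rule cinner_proj)
    also have "proj {0..} (wm n) = 0" by (rule proj_disjoint[OF wm(2)]) auto
    finally show ?thesis by simp
  qed
  have rec_p: "T (wp k) = a (int k) *\<^sub>R v (int k - 1) + b (int k) *\<^sub>R v (int k) + a (int k + 1) *\<^sub>R v (int k + 1)" for k
  proof -
    have "T (wp k) = compress {0..} T (wp k) + proj {..<0} (T (wp k))"
      using proj_split[of "T (wp k)"] by (simp add: compress_def wp(2))
    also have "proj {..<0} (T (wp k)) = cscale (cinner (wp k) (a 0 *\<^sub>R wp 0)) (basis_vec (- 1))"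
      using coupling_from_plus[OF T(2,3) wp(2)] by (simp add: e0 wp(1))
    \<comment> \<open>Orthogonality to \<open>wp 0\<close> confines the coupling to the first vector
      of the half.\<close>
    also have "\<dots> = (if k = 0 then a 0 *\<^sub>R basis_vec (- 1) else 0)"
      by (intro ell2_eqI) (simp add: cinner_scaleR_right wp(3) cinner_basis_right)
    finally have eq: "T (wp k) = compress {0..} T (wp k) + (if k = 0 then a 0 *\<^sub>R basis_vec (- 1) else 0)" .
    show ?thesis
    proof (cases k)
      case 0
      with eq show ?thesis
        using v_minus[of 0] v_plus[of 1] v_plus[of 0] wp(4)[of 0] by (simp add: wp(1) wm(1) del: v_plus v_minus)
    next
      case (Suc m)
      with eq show ?thesis
        using v_plus[of m] v_plus[of k] v_plus[of "Suc k"] by (simp add: wp algebra_simps del: v_plus v_minus)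
    qed
  qed
  have rec_m: "T (wm k) = a (- 1 - int k) *\<^sub>R v (- 1 - int k - 1) + b (- 1 - int k) *\<^sub>R v (- 1 - int k)
      + a (- 1 - int k + 1) *\<^sub>R v (- 1 - int k + 1)" for k
  proof -
    have "T (wm k) = proj {0..} (T (wm k)) + compress {..<0} T (wm k)"
      using proj_split[of "T (wm k)"] by (simp add: compress_def wm(2))
    also have "proj {0..} (T (wm k)) = cscale (ell2_nth (wm k) (- 1)) (a 0 *\<^sub>R wp 0)"
      using coupling_from_minus[OF T(2,3) wm(2)] by (simp add: e0 wp(1))
    also have "ell2_nth (wm k) (- 1) = cinner (wm k) (wm 0)"
      by (simp add: wm(1) cinner_basis_right)
    also have "cscale \<dots> (a 0 *\<^sub>R wp 0) = (if k = 0 then a 0 *\<^sub>R wp 0 else 0)"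
      by (intro ell2_eqI) (simp add: wm(3) cinner_basis_right)
    finally have eq: "T (wm k) = (if k = 0 then a 0 *\<^sub>R wp 0 else 0) + compress {..<0} T (wm k)" .
    show ?thesis
    proof (cases k)
      case 0
      with eq show ?thesis
        using v_minus[of 0] v_minus[of 1] v_plus[of 0] wm(4)[of 0] by (simp del: v_plus v_minus)
    next
      case (Suc m)
      with eq show ?thesis
        using v_minus[of m] v_minus[of k] v_minus[of "Suc k"] by (simp add: wm(4) algebra_simps del: v_plus v_minus)
    qed
  qed
  have cases_int: "(\<exists>k. n = int k) \<or> (\<exists>k. n = - 1 - int k)" for n
    by presburger
  have "adapted_basis T a b v"
    unfolding adapted_basis_def
  proof (intro conjI allI impI)
    show "v (- 1) = basis_vec (- 1)" using v_minus[of 0] wm(1) by simp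
    show "proj {0..} (v n) = v n" if "n \<ge> 0" for n using that wp(2) by (simp add: v_def)
    show "proj {..<0} (v n) = v n" if "n < 0" for n using that wm(2) by (simp add: v_def)
    show "cinner (v m) (v n) = (if m = n then 1 else 0)" for m n
      using orth[of "nat m" "nat (- 1 - n)"] orth[of "nat n" "nat (- 1 - m)"]
      by (auto simp: v_def wp(3) wm(3) cinner_basis_right cinner_commute[of "wm _" "wp _"])
    show "T (v n) = a n *\<^sub>R v (n - 1) + b n *\<^sub>R v n + a (n + 1) *\<^sub>R v (n + 1)" for n
      using cases_int[of n] rec_p rec_m by (auto simp del: minus_diff_commute)
  qed
  then show ?thesis by blast
qed

section \<open>Block diagonal operators\<close>

definition block_pos :: "nat \<Rightarrow> int \<Rightarrow> nat \<Rightarrow> int" where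
  "block_pos g j i = j * int (g + 1) + int i"

lemma block_pos_div_mod:
  assumes "i \<le> g"
  shows "block_pos g j i div int (g + 1) = j" "block_pos g j i mod int (g + 1) = int i"
proof -
  have i: "0 \<le> int i" "int i < int (g + 1)" using assms by auto
  show "block_pos g j i div int (g + 1) = j" "block_pos g j i mod int (g + 1) = int i"
    using i by (simp_all add: block_pos_def del: of_nat_Suc of_nat_add)
qed

lemma block_pos_neg_iff:
  assumes "i \<le> g"
  shows "block_pos g j i < 0 \<longleftrightarrow> j < 0"
  using pos_imp_zdiv_neg_iff[of "int (g + 1)" "block_pos g j i"] block_pos_div_mod[OF assms]
  by (simp del: of_nat_Suc of_nat_add)

lemma block_pos_cases:
  obtains j i where "n = block_pos g j i" "i \<le> g"
proof
  have "n mod int (g + 1) < int (g + 1)" by simp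
  then have "0 \<le> n mod int (g + 1)" "n mod int (g + 1) \<le> int g"
    by (simp, linarith)
  then show "nat (n mod int (g + 1)) \<le> g" "n = block_pos g (n div int (g + 1)) (nat (n mod int (g + 1)))"
    by (simp_all add: block_pos_def nat_le_iff del: of_nat_Suc of_nat_add)
qed

lemma block_pos_inject:
  assumes "i \<le> g" "l \<le> g"
  shows "block_pos g j i = block_pos g k l \<longleftrightarrow> j = k \<and> i = l"
  using block_pos_div_mod[OF assms(1), of j] block_pos_div_mod[OF assms(2), of k]
  by (metis of_nat_eq_iff)

lemma block_pos_minus_1: "block_pos g (- 1) g = - 1"
  by (simp add: block_pos_def)

lemma block_pos_0: "block_pos g 0 0 = 0"
  by (simp add: block_pos_def)

lemma ell2_eq_blockI:
  assumes "\<And>j i. i \<le> g \<Longrightarrow> ell2_nth x (block_pos g j i) = ell2_nth y (block_pos g j i)"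
  shows "x = y"
proof (rule ell2_eqI)
  fix n
  obtain j i where "n = block_pos g j i" "i \<le> g" by (rule block_pos_cases)
  then show "ell2_nth x n = ell2_nth y n" using assms by simp
qed

lemma cinner_blocks:
  "cinner x y = (\<Sum>\<^sub>\<infinity>j. \<Sum>i\<le>g. ell2_nth x (block_pos g j i) * cnj (ell2_nth y (block_pos g j i)))"
proof -
  let ?f = "\<lambda>n. ell2_nth x n * cnj (ell2_nth y n)"
  let ?h = "\<lambda>(j, i). block_pos g j i"
  have bij: "bij_betw ?h (UNIV \<times> {..g}) UNIV"
  proof (rule bij_betwI')
    fix a b :: "int \<times> nat" assume "a \<in> UNIV \<times> {..g}" "b \<in> UNIV \<times> {..g}"
    then show "(?h a = ?h b) = (a = b)"
      by (cases a; cases b) (simp add: block_pos_inject)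
  next
    fix n :: int
    obtain j i where "n = block_pos g j i" "i \<le> g" by (rule block_pos_cases)
    then show "\<exists>a\<in>UNIV \<times> {..g}. n = ?h a" by (intro bexI[of _ "(j, i)"]) auto
  qed simp
  have "cinner x y = (\<Sum>\<^sub>\<infinity>a\<in>UNIV \<times> {..g}. ?f (?h a))"
    unfolding cinner_def by (rule infsum_reindex_bij_betw[OF bij, symmetric])
  also have "\<dots> = (\<Sum>\<^sub>\<infinity>j. \<Sum>\<^sub>\<infinity>i\<in>{..g}. ?f (?h (j, i)))"
  proof (rule infsum_Sigma_banach[symmetric])
    show "(\<lambda>a. ?f (?h a)) summable_on UNIV \<times> {..g}"
      using summable_on_reindex_bij_betw[OF bij, of ?f] cinner_summable by blast
  qed
  finally show ?thesis by simp
qed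

text \<open>\<open>Abs_ell2\<close> can be undone only for a square summable argument. Positions
  within a block differ by at most \<open>g\<close>, so the image is dominated by \<open>K\<close>
  times the sum \<open>s\<close> of the shifts of |x| by -g, ..., g.\<close>

lemma ell2_nth_block_diag:
  assumes K: "\<And>j i l. i \<le> g \<Longrightarrow> l \<le> g \<Longrightarrow> \<bar>M j i l\<bar> \<le> K" and i: "i \<le> g"
  shows "ell2_nth (block_diag g M x) (block_pos g j i) =
    (\<Sum>l\<le>g. of_real (M j i l) * ell2_nth x (block_pos g j l))"
proof -
  define f where "f n = (let j = n div int (g + 1); i = nat (n mod int (g + 1))
     in \<Sum>l\<le>g. of_real (M j i l) * ell2_nth x (block_pos g j l))" for n
  have f: "f (block_pos g j i) = (\<Sum>l\<le>g. of_real (M j i l) * ell2_nth x (block_pos g j l))"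
    if "i \<le> g" for j i
    unfolding f_def block_pos_div_mod[OF that] Let_def by (simp add: block_pos_def)
  define y where "y = Abs_ell2 (\<lambda>n. of_real (cmod (ell2_nth x n)))"
  have y: "ell2_nth y n = of_real (cmod (ell2_nth x n))" for n
    unfolding y_def by (subst Abs_ell2_inverse) (simp_all add: ell2_nth_summable)
  define s where "s = (\<Sum>k\<in>{- int g..int g}. shift k y)"
  have bound: "cmod (f n) \<le> cmod (ell2_nth (cscale (of_real K) s) n)" for n
  proof -
    obtain j i where n: "n = block_pos g j i" and i: "i \<le> g" by (rule block_pos_cases)
    have K0: "K \<ge> 0" using K[of 0 0] by (meson abs_ge_zero le0 order_trans)
    have "cmod (f n) \<le> (\<Sum>l\<le>g. cmod (of_real (M j i l) * ell2_nth x (block_pos g j l)))"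
      unfolding n f[OF i] by (rule norm_sum)
    also have "\<dots> \<le> (\<Sum>l\<le>g. K * cmod (ell2_nth x (n - (int i - int l))))"
      using K i by (intro sum_mono) (auto simp: norm_mult n block_pos_def intro!: mult_right_mono)
    also have "\<dots> = (\<Sum>k\<in>(\<lambda>l. int i - int l) ` {..g}. K * cmod (ell2_nth x (n - k)))"
      by (subst sum.reindex) (auto simp: inj_on_def)
    also have "\<dots> \<le> (\<Sum>k\<in>{- int g..int g}. K * cmod (ell2_nth x (n - k)))"
      using i K0 by (intro sum_mono2) auto
    also have "\<dots> = Re (ell2_nth (cscale (of_real K) s) n)"
      by (simp add: s_def y sum_distrib_left)
    also have "\<dots> \<le> cmod (ell2_nth (cscale (of_real K) s) n)" by (rule complex_Re_le_cmod)
    finally show ?thesis .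
  qed
  have "(\<lambda>n. (cmod (f n))\<^sup>2) summable_on UNIV"
    by (rule summable_on_comparison_test[OF ell2_nth_summable[of "cscale (of_real K) s"]])
      (intro power_mono bound, simp_all)
  moreover have "block_diag g M x = Abs_ell2 f"
    unfolding block_diag_def f_def block_pos_def by simp
  ultimately show ?thesis using f[OF i] by (simp add: Abs_ell2_inverse)
qed

text \<open>Rows and columns are both required to be orthonormal, so the notion is visibly invariant
  under transposition and each fact about \<open>M\<close> also serves its transpose.\<close>

definition orthogonal_blocks :: "nat \<Rightarrow> (int \<Rightarrow> nat \<Rightarrow> nat \<Rightarrow> real) \<Rightarrow> bool" where
  "orthogonal_blocks g M \<longleftrightarrow> (\<forall>j. \<forall>i\<le>g. \<forall>l\<le>g.
     (\<Sum>k\<le>g. M j i k * M j l k) = (if i = l then 1 else 0) \<and>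
     (\<Sum>k\<le>g. M j k i * M j k l) = (if i = l then 1 else 0))"

lemma orthogonal_blocks_transpose:
  "orthogonal_blocks g M \<Longrightarrow> orthogonal_blocks g (\<lambda>j i l. M j l i)"
  by (simp add: orthogonal_blocks_def)

context
  fixes g :: nat and M :: "int \<Rightarrow> nat \<Rightarrow> nat \<Rightarrow> real"
  assumes M: "orthogonal_blocks g M"
begin

lemma orthogonal_blocks_bound:
  assumes "i \<le> g" "l \<le> g"
  shows "\<bar>M j i l\<bar> \<le> 1"
proof -
  have "(M j i l)\<^sup>2 \<le> (\<Sum>k\<le>g. (M j i k)\<^sup>2)"
    using assms by (intro member_le_sum) auto
  also have "\<dots> = 1" using M assms by (simp add: orthogonal_blocks_def power2_eq_square)
  finally show ?thesis by (simp add: abs_square_le_1)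
qed

lemma ell2_nth_orthogonal_block_diag:
  assumes "i \<le> g"
  shows "ell2_nth (block_diag g M x) (block_pos g j i) =
    (\<Sum>l\<le>g. of_real (M j i l) * ell2_nth x (block_pos g j l))"
  using assms by (intro ell2_nth_block_diag[where K = 1] orthogonal_blocks_bound)

lemma linear_orthogonal_block_diag: "linear (block_diag g M)"
proof (rule linearI)
  show "block_diag g M (x + y) = block_diag g M x + block_diag g M y" for x y
    by (rule ell2_eq_blockI[of g])
      (simp add: ell2_nth_orthogonal_block_diag algebra_simps sum.distrib)
  show "block_diag g M (r *\<^sub>R x) = r *\<^sub>R block_diag g M x" for r x
    by (rule ell2_eq_blockI[of g])
      (simp add: ell2_nth_orthogonal_block_diag sum_distrib_left mult.left_commute)
qed

text \<open>The cut between -1 and 0 is a block boundary, and the operator acts within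
  blocks.\<close>

lemma proj_orthogonal_block_diag:
  assumes "proj N x = x" "N = {0..} \<or> N = {..<0}"
  shows "proj N (block_diag g M x) = block_diag g M x"
  unfolding proj_eq_self_iff
proof (intro allI impI)
  fix n assume n: "n \<notin> N"
  obtain j i where ji: "n = block_pos g j i" "i \<le> g" by (rule block_pos_cases)
  have "block_pos g j l \<notin> N" if "l \<le> g" for l
    using n assms(2) block_pos_neg_iff[OF ji(2), of j] block_pos_neg_iff[OF that, of j] ji(1) by auto
  then have "ell2_nth x (block_pos g j l) = 0" if "l \<le> g" for l
    using assms(1) that by (simp add: proj_eq_self_iff)
  then show "ell2_nth (block_diag g M x) n = 0"
    unfolding ji(1) ell2_nth_orthogonal_block_diag[OF ji(2)] by (intro sum.neutral) auto
qed

end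

lemma orthogonal_block_diag_inverse:
  assumes M: "orthogonal_blocks g M"
  shows "block_diag g M (block_diag g (\<lambda>j i l. M j l i) x) = x"
proof (rule ell2_eq_blockI)
  fix j i assume i: "i \<le> g"
  let ?x = "\<lambda>l. ell2_nth x (block_pos g j l)"
  have "ell2_nth (block_diag g M (block_diag g (\<lambda>j i l. M j l i) x)) (block_pos g j i) =
      (\<Sum>k\<le>g. \<Sum>l\<le>g. of_real (M j i k * M j l k) * ?x l)"
    unfolding ell2_nth_orthogonal_block_diag[OF M i]
    by (intro sum.cong refl)
      (simp add: ell2_nth_orthogonal_block_diag[OF orthogonal_blocks_transpose[OF M]] sum_distrib_left
        mult.assoc)
  also have "\<dots> = (\<Sum>l\<le>g. \<Sum>k\<le>g. of_real (M j i k * M j l k) * ?x l)" by (rule sum.swap)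
  also have "\<dots> = (\<Sum>l\<le>g. of_real (\<Sum>k\<le>g. M j i k * M j l k) * ?x l)"
    by (simp add: sum_distrib_right)
  also have "\<dots> = (\<Sum>l\<le>g. if i = l then ?x l else 0)"
    using M i by (intro sum.cong refl) (simp add: orthogonal_blocks_def)
  also have "\<dots> = ?x i" using i by simp
  finally show "ell2_nth (block_diag g M (block_diag g (\<lambda>j i l. M j l i) x)) (block_pos g j i) = ?x i" .
qed

lemma cinner_orthogonal_block_diag:
  assumes M: "orthogonal_blocks g M"
  shows "cinner (block_diag g M x) y = cinner x (block_diag g (\<lambda>j i l. M j l i) y)"
proof -
  let ?x = "\<lambda>j l. ell2_nth x (block_pos g j l)" and ?y = "\<lambda>j l. ell2_nth y (block_pos g j l)"
  have "(\<Sum>i\<le>g. (\<Sum>l\<le>g. of_real (M j i l) * ?x j l) * cnj (?y j i)) =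
      (\<Sum>l\<le>g. ?x j l * cnj (\<Sum>i\<le>g. of_real (M j i l) * ?y j i))" for j
    unfolding sum_distrib_right by (subst sum.swap) (simp add: sum_distrib_left algebra_simps)
  then show ?thesis
    unfolding cinner_blocks[of _ _ g]
    by (simp add: ell2_nth_orthogonal_block_diag[OF M]
        ell2_nth_orthogonal_block_diag[OF orthogonal_blocks_transpose[OF M]])
qed

lemma adjoint_op_orthogonal_block_diag:
  assumes "orthogonal_blocks g M"
  shows "adjoint_op (block_diag g M) = block_diag g (\<lambda>j i l. M j l i)"
  unfolding adjoint_op_def
proof (rule the_equality)
  fix T' assume T': "\<forall>x y. cinner (block_diag g M x) y = cinner x (T' y)"
  show "T' = block_diag g (\<lambda>j i l. M j l i)"
  proof
    fix y
    show "T' y = block_diag g (\<lambda>j i l. M j l i) y"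
      by (rule ell2_eq_cinnerI) (simp add: T'[rule_format, symmetric] cinner_orthogonal_block_diag[OF assms])
  qed
qed (simp add: cinner_orthogonal_block_diag[OF assms])

lemma block_eq_entry: "block g T j k i l = entry T (block_pos g j i) (block_pos g k l)"
  by (simp add: block_def block_pos_def)

section \<open>The orthogonal matrix \<open>U(p)\<close>\<close>

context
  fixes g :: nat and p :: "nat \<Rightarrow> real" and s :: "nat \<Rightarrow> real"
  assumes pg: "p g > 0"
  defines "s k \<equiv> L2_set p {k..g}"
begin

lemma tail_norm_pos: "k \<le> g \<Longrightarrow> s k > 0"
proof -
  assume "k \<le> g"
  then have "0 < (\<Sum>i=k..g. (p i)\<^sup>2)"
    using pg by (intro sum_pos2[of _ g]) auto
  then show ?thesis by (simp add: s_def L2_set_def)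
qed

lemma tail_norm_sq: "(s k)\<^sup>2 = (\<Sum>i=k..g. (p i)\<^sup>2)"
  by (simp add: s_def L2_set_def sum_nonneg)

lemma tail_norm_step: "k < g \<Longrightarrow> (s k)\<^sup>2 = (p k)\<^sup>2 + (s (Suc k))\<^sup>2"
  unfolding tail_norm_sq by (rule sum.atLeast_Suc_atMost) simp

lemma U_mat_cases:
  "U_mat g p i 0 = p i / s 0"
  "U_mat g p i (Suc k) = (if i < k then 0 else if i = k then (s (Suc k))\<^sup>2 else - p k * p i) / (s k * s (Suc k))"
  by (simp_all add: U_mat_def s_def atMost_atLeast0)

text \<open>In rows from \<open>k\<close> on, the columns up to \<open>k\<close> are proportional to
  \<open>p\<close>, and the sum telescopes through 1 / s_k^2 + p_k^2 / (s_k^2 s_{k+1}^2) = 1 /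
  s_{k+1}^2.\<close>

lemma U_mat_row_partial:
  assumes "k \<le> i" "k \<le> l" "i \<le> g"
  shows "(\<Sum>m\<le>k. U_mat g p i m * U_mat g p l m) = p i * p l / (s k)\<^sup>2"
  using assms
proof (induction k)
  case 0
  then show ?case by (simp add: U_mat_cases power2_eq_square)
next
  case (Suc k)
  have pos: "s k > 0" "s (Suc k) > 0" using Suc.prems by (auto intro!: tail_norm_pos)
  have step: "(s k)\<^sup>2 = (p k)\<^sup>2 + (s (Suc k))\<^sup>2" using Suc.prems by (intro tail_norm_step) auto
  have "(\<Sum>m\<le>Suc k. U_mat g p i m * U_mat g p l m) =
      p i * p l / (s k)\<^sup>2 + (p k)\<^sup>2 * (p i * p l) / ((s k)\<^sup>2 * (s (Suc k))\<^sup>2)"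
    using Suc by (simp add: U_mat_cases power2_eq_square algebra_simps)
  also have "\<dots> = p i * p l * ((p k)\<^sup>2 + (s (Suc k))\<^sup>2) / ((s k)\<^sup>2 * (s (Suc k))\<^sup>2)"
    using pos by (simp add: field_simps)
  also have "\<dots> = p i * p l / (s (Suc k))\<^sup>2"
    using pos unfolding step[symmetric] by simp
  finally show ?case .
qed

text \<open>Row \<open>i\<close> vanishes beyond column i + 1, so one term is added to the partial
  sum up to column \<open>i\<close>; in the last row the partial sum is already complete.\<close>

lemma U_mat_rows_le:
  assumes "i \<le> l" "l \<le> g"
  shows "(\<Sum>m\<le>g. U_mat g p i m * U_mat g p l m) = (if i = l then 1 else 0)"
proof (cases "i = g")
  case True
  then have "l = g" using assms by simp
  then show ?thesis
    using True U_mat_row_partial[of g g g] tail_norm_pos[of g] tail_norm_sq[of g] pg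
    by (simp add: power2_eq_square)
next
  case False
  then have i: "i < g" using assms by simp
  have pos: "s i > 0" "s (Suc i) > 0" using i by (auto intro!: tail_norm_pos)
  have "(\<Sum>m\<le>g. U_mat g p i m * U_mat g p l m) = (\<Sum>m\<le>Suc i. U_mat g p i m * U_mat g p l m)"
    using i by (intro sum.mono_neutral_right) (auto simp: U_mat_cases not_le Suc_lessE elim!: Suc_lessE)
  also have "\<dots> = p i * p l / (s i)\<^sup>2 + U_mat g p i (Suc i) * U_mat g p l (Suc i)"
    using U_mat_row_partial[of i i l] assms i by simp
  also have "\<dots> = (if i = l then 1 else 0)"
  proof (cases "i = l")
    case True
    have "p i * p i / (s i)\<^sup>2 + U_mat g p i (Suc i) * U_mat g p i (Suc i) = ((p i)\<^sup>2 + (s (Suc i))\<^sup>2) / (s i)\<^sup>2"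
      using pos by (simp add: U_mat_cases power2_eq_square field_simps)
    also have "\<dots> = 1" using pos unfolding tail_norm_step[OF i, symmetric] by simp
    finally show ?thesis using True by simp
  next
    case False
    then show ?thesis
      using assms pos by (simp add: U_mat_cases power2_eq_square field_simps)
  qed
  finally show ?thesis .
qed

text \<open>Column n + 1 vanishes above row \<open>n\<close> and is orthogonal to the tail of
  \<open>p\<close> starting there, while every earlier column agrees with a multiple
  \<open>c\<close> of \<open>p\<close> on that tail.\<close>

lemma U_mat_cols_le:
  assumes "k \<le> m" "m \<le> g"
  shows "(\<Sum>i\<le>g. U_mat g p i k * U_mat g p i m) = (if k = m then 1 else 0)"
proof (cases m)
  case 0
  have "(\<Sum>i\<le>g. (p i / s 0) * (p i / s 0)) = (\<Sum>i\<le>g. (p i)\<^sup>2) / (s 0)\<^sup>2"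
    by (simp add: sum_divide_distrib power2_eq_square)
  also have "\<dots> = 1"
    using zero_less_power[OF tail_norm_pos[of 0], of 2] unfolding tail_norm_sq by (simp add: atMost_atLeast0)
  finally show ?thesis using 0 assms by (simp add: U_mat_cases)
next
  case (Suc n)
  have n: "n < g" using Suc assms by simp
  have pos: "s n > 0" "s (Suc n) > 0" using n by (auto intro!: tail_norm_pos)
  have split: "(\<Sum>i\<le>g. U_mat g p i k * U_mat g p i m) =
      U_mat g p n k * U_mat g p n m + (\<Sum>i=Suc n..g. U_mat g p i k * U_mat g p i m)"
  proof -
    have "(\<Sum>i\<le>g. U_mat g p i k * U_mat g p i m) = (\<Sum>i=n..g. U_mat g p i k * U_mat g p i m)"
      using n by (intro sum.mono_neutral_right) (auto simp: U_mat_cases Suc)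
    also have "\<dots> = U_mat g p n k * U_mat g p n m + (\<Sum>i=Suc n..g. U_mat g p i k * U_mat g p i m)"
      using n by (intro sum.atLeast_Suc_atMost) simp
    finally show ?thesis .
  qed
  show ?thesis
  proof (cases "k = m")
    case True
    have "(\<Sum>i=Suc n..g. U_mat g p i m * U_mat g p i m) =
        (\<Sum>i=Suc n..g. (p n)\<^sup>2 / (s n * s (Suc n))\<^sup>2 * (p i)\<^sup>2)"
      by (intro sum.cong) (auto simp: Suc U_mat_cases power2_eq_square)
    also have "\<dots> = (p n)\<^sup>2 / (s n * s (Suc n))\<^sup>2 * (s (Suc n))\<^sup>2"
      by (simp only: sum_distrib_left[symmetric] tail_norm_sq)
    finally have "(\<Sum>i\<le>g. U_mat g p i k * U_mat g p i m) = ((p n)\<^sup>2 + (s (Suc n))\<^sup>2) / (s n)\<^sup>2"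
      unfolding split using pos by (simp add: True Suc U_mat_cases power2_eq_square field_simps)
    then show ?thesis using pos True unfolding tail_norm_step[OF n, symmetric] by simp
  next
    case False
    then have kn: "k \<le> n" using assms Suc by simp
    obtain c where c: "\<And>i. i \<ge> n \<Longrightarrow> U_mat g p i k = c * p i"
    proof (cases k)
      case 0
      then show ?thesis using that[of "1 / s 0"] by (simp add: U_mat_cases)
    next
      case (Suc k')
      then show ?thesis
        using that[of "- p k' / (s k' * s k)"] kn by (simp add: U_mat_cases)
    qed
    have "(\<Sum>i=Suc n..g. U_mat g p i k * U_mat g p i m) =
        (\<Sum>i=Suc n..g. - c * p n / (s n * s (Suc n)) * (p i)\<^sup>2)"
      by (intro sum.cong) (auto simp: Suc U_mat_cases power2_eq_square c)
    also have "\<dots> = - c * p n / (s n * s (Suc n)) * (s (Suc n))\<^sup>2"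
      by (simp only: sum_distrib_left[symmetric] tail_norm_sq)
    finally show ?thesis unfolding split using False by (simp add: c Suc U_mat_cases)
  qed
qed

lemma U_mat_orthogonal:
  assumes "i \<le> g" "l \<le> g"
  shows "(\<Sum>k\<le>g. U_mat g p i k * U_mat g p l k) = (if i = l then 1 else 0)"
    and "(\<Sum>k\<le>g. U_mat g p k i * U_mat g p k l) = (if i = l then 1 else 0)"
  using U_mat_rows_le[of i l] U_mat_rows_le[of l i] U_mat_cols_le[of i l] U_mat_cols_le[of l i] assms
  by (cases "i \<le> l"; simp add: mult.commute)+

end

section \<open>Entries of operators of class \<open>\<bbbA>(C)\<close>\<close>

context
  fixes C :: "real list" and T :: "ell2 \<Rightarrow> ell2" and p q :: "int \<Rightarrow> nat \<Rightarrow> real" and g :: nat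
  assumes gen: "generating_coeffs C T p q" and g: "length C = g"
begin

lemma class_A_entry:
  assumes "i \<le> g" "l \<le> g"
  shows "entry T (block_pos g j i) (block_pos g k l) = of_real
    (if k = j then B_mat C (p j) (q j) i l else if k = j + 1 then A_mat g (p k) i l
     else if k = j - 1 then A_mat g (p j) l i else 0)"
proof -
  have *: "block g T j j i l = of_real (B_mat C (p j) (q j) i l)"
    "block g T (j - 1) j i l = of_real (A_mat g (p j) i l)"
    "block g T j (j - 1) i l = of_real (A_mat g (p j) l i)"
    "\<bar>j - k\<bar> \<ge> 2 \<Longrightarrow> block g T j k i l = 0" for j k
    using gen assms unfolding generating_coeffs_def g Let_def by blast+
  consider "k = j" | "k = j + 1" | "k = j - 1" | "\<bar>j - k\<bar> \<ge> 2" by linarith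
  then show ?thesis
    using *(1)[of j] *(2)[of k] *(3)[of j] *(4)[of j k] by cases (auto simp: block_eq_entry)
qed

lemma p_last_pos: "p j g > 0"
  using gen unfolding generating_coeffs_def g Let_def by blast

lemma class_A_symmetric:
  assumes "bounded_op T"
  shows "symmetric_op T"
proof (rule symmetric_op_if_entries[OF assms])
  fix m n
  obtain j i k l where ji: "m = block_pos g j i" "i \<le> g" and kl: "n = block_pos g k l" "l \<le> g"
    by (metis block_pos_cases)
  have "B_mat C (p j) (q j) i l = B_mat C (p j) (q j) l i"
    by (auto simp: B_mat_def)
  then show "entry T m n = cnj (entry T n m)"
    unfolding ji(1) kl(1) class_A_entry[OF ji(2) kl(2)] class_A_entry[OF kl(2) ji(2)] by auto
qed

text \<open>The block (0, -1) is the transpose of A(p_0), whose only nonzero row is the last. Hence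
  its only nonzero column is the last of block -1, that is, index -1; this is the source of the rank
  one coupling.\<close>

lemma class_A_far:
  assumes "m < - 1"
  shows "proj {0..} (T (basis_vec m)) = 0"
proof (rule ell2_eqI)
  fix n
  obtain j i k l where ji: "n = block_pos g j i" "i \<le> g" and kl: "m = block_pos g k l" "l \<le> g"
    by (metis block_pos_cases)
  have "ell2_nth (T (basis_vec m)) n = 0" if "n \<ge> 0"
  proof -
    have "j \<ge> 0" "k < 0"
      using that assms ji kl block_pos_neg_iff[OF ji(2), of j] block_pos_neg_iff[OF kl(2), of k] by auto
    moreover have "l \<noteq> g" if "k = - 1" using that kl assms block_pos_minus_1[of g] by auto
    ultimately show ?thesis
      using class_A_entry[OF ji(2) kl(2), of j k] by (auto simp: entry_def cinner_basis_right ji kl A_mat_def)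
  qed
  then show "ell2_nth (proj {0..} (T (basis_vec m))) n = ell2_nth 0 n" by simp
qed

lemma ell2_nth_coupling_vector:
  assumes "i \<le> g"
  shows "ell2_nth (proj {0..} (T (basis_vec (- 1)))) (block_pos g j i) = (if j = 0 then of_real (p 0 i) else 0)"
  using class_A_entry[OF assms order_refl, of j "- 1"] block_pos_neg_iff[OF assms, of j]
  by (auto simp: entry_def cinner_basis_right block_pos_minus_1 A_mat_def)

lemma norm_coupling_vector: "norm (proj {0..} (T (basis_vec (- 1)))) = L2_set (p 0) {..g}"
proof -
  let ?w = "proj {0..} (T (basis_vec (- 1)))"
  have "cinner ?w ?w = (\<Sum>\<^sub>\<infinity>j::int. if j = 0 then of_real (\<Sum>i\<le>g. (p 0 i)\<^sup>2) else 0)"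
    unfolding cinner_blocks[of _ _ g]
    by (rule infsum_cong) (simp add: ell2_nth_coupling_vector power2_eq_square del: ell2_nth_simps(9))
  also have "\<dots> = (\<Sum>\<^sub>\<infinity>j\<in>{0::int}. of_real (\<Sum>i\<le>g. (p 0 i)\<^sup>2))"
    by (rule infsum_cong_neutral) auto
  finally have "complex_of_real ((norm ?w)\<^sup>2) = of_real (\<Sum>i\<le>g. (p 0 i)\<^sup>2)"
    unfolding cinner_self by simp
  then have "(norm ?w)\<^sup>2 = (\<Sum>i\<le>g. (p 0 i)\<^sup>2)" by (simp only: of_real_eq_iff)
  then have "(norm ?w)\<^sup>2 = (L2_set (p 0) {..g})\<^sup>2"
    by (simp add: L2_set_def sum_nonneg)
  then show ?thesis by (rule power2_eq_imp_eq) simp_all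
qed

text \<open>Index -1 is position \<open>g\<close> of block -1, where diag(c_1, ..., c_g, 0)
  contributes 0.\<close>

lemma entry_minus_1: "entry T (- 1) (- 1) = of_real (q (- 1) g * p (- 1) g)"
  using class_A_entry[of g g "- 1" "- 1"] by (simp add: block_pos_minus_1 B_mat_def g mult.commute)

end

section \<open>The flow shifts the adapted basis\<close>

lemma linear_shift: "linear (shift k)"
  by (rule linearI) (auto intro!: ell2_eqI)

lemma shift_shift [simp]: "shift k (shift l x) = shift (k + l) x" "shift 0 x = x"
  by (auto intro!: ell2_eqI simp: algebra_simps)

lemma shift_basis_vec [simp]: "shift k (basis_vec n) = basis_vec (n + k)"
  by (rule ell2_eqI) auto

lemma cinner_shift [simp]: "cinner (shift k x) (shift k y) = cinner x y"
proof -
  have "bij (\<lambda>n::int. n - k)"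
    by (rule bij_betw_byWitness[where f' = "\<lambda>n. n + k"]) auto
  from infsum_reindex_bij_betw[OF this, of "\<lambda>n. ell2_nth x n * cnj (ell2_nth y n)"]
  show ?thesis by (simp add: cinner_def)
qed

text \<open>Serves to identify the vectors at the cut, which are known up to positive
  factors.\<close>

lemma scaleR_unit_eqD:
  fixes x y :: ell2
  assumes "c *\<^sub>R x = d *\<^sub>R y" "c > 0" "d > 0" "cinner x x = 1" "cinner y y = 1"
  shows "x = y"
proof -
  have "norm x = 1" "norm y = 1"
    using assms(4,5) by (simp_all add: norm_eq_1_iff)
  then have "c = d"
    using arg_cong[OF assms(1), of norm] assms(2,3) by simp
  then show ?thesis using assms(1,2) by simp
qed

text \<open>Collects what the flow arguments use of U_A: it is unitary with inverse
  \<open>V\<close>, it respects both half-lines, and it sends e_0 to the direction of P_+ T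
  e_{-1}.\<close>

lemma jacobi_flow_unitary:
  assumes "class_A C T"
  obtains U V c where
    "\<And>x. jacobi_flow C T x = shift (- 1) (V (T (U (shift 1 x))))"
    "linear U" "linear V" "\<And>x. U (V x) = x" "\<And>x. V (U x) = x" "\<And>x y. cinner (V x) y = cinner x (U y)"
    "\<And>N x. N = {0..} \<or> N = {..<0} \<Longrightarrow> proj N x = x \<Longrightarrow> proj N (U x) = U x"
    "\<And>N x. N = {0..} \<or> N = {..<0} \<Longrightarrow> proj N x = x \<Longrightarrow> proj N (V x) = V x"
    "c > 0" "proj {0..} (T (basis_vec (- 1))) = c *\<^sub>R U (basis_vec 0)"
proof -
  define g where "g = length C"
  let ?p = "p_coeffs C T"
  have "\<exists>p q. generating_coeffs C T p q" using assms by (simp add: class_A_def)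
  then have "\<exists>q. generating_coeffs C T ?p q"
    unfolding p_coeffs_def by (rule someI_ex)
  then obtain q where gen: "generating_coeffs C T ?p q" by blast
  note gen = gen g_def[symmetric]
  let ?M = "\<lambda>j. U_mat g (?p j)" and ?N = "\<lambda>j i l. U_mat g (?p j) l i"
  have M: "orthogonal_blocks g ?M"
    unfolding orthogonal_blocks_def by (intro allI impI conjI U_mat_orthogonal p_last_pos[OF gen])
  note N = orthogonal_blocks_transpose[OF M]
  show thesis
  proof (rule that)
    show "jacobi_flow C T x = shift (- 1) (block_diag g ?N (T (block_diag g ?M (shift 1 x))))" for x
      by (simp add: jacobi_flow_def g_def[symmetric] adjoint_op_orthogonal_block_diag[OF M])
    show "linear (block_diag g ?M)" "linear (block_diag g ?N)"
      by (rule linear_orthogonal_block_diag[OF M], rule linear_orthogonal_block_diag[OF N])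
    show "block_diag g ?M (block_diag g ?N x) = x" "block_diag g ?N (block_diag g ?M x) = x" for x
      using orthogonal_block_diag_inverse[OF M] orthogonal_block_diag_inverse[OF N] by simp_all
    show "cinner (block_diag g ?N x) y = cinner x (block_diag g ?M y)" for x y
      using cinner_orthogonal_block_diag[OF N] by simp
    show "proj N (block_diag g ?M x) = block_diag g ?M x" "proj N (block_diag g ?N x) = block_diag g ?N x"
      if "N = {0..} \<or> N = {..<0}" "proj N x = x" for N x
      using proj_orthogonal_block_diag[OF M that(2,1)] proj_orthogonal_block_diag[OF N that(2,1)] by simp_all
    show c: "L2_set (?p 0) {..g} > 0"
      using tail_norm_pos[where g = g and p = "?p 0" and k = 0, OF p_last_pos[OF gen]] by (simp add: atMost_atLeast0)
    \<comment> \<open>Both sides are supported in block 0; there the left side is p_0 and the right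
      side is its norm times the first column of U(p_0).\<close>
    show "proj {0..} (T (basis_vec (- 1))) = L2_set (?p 0) {..g} *\<^sub>R block_diag g ?M (basis_vec 0)"
    proof (rule ell2_eq_blockI)
      fix j i assume i: "i \<le> g"
      have "(\<Sum>l\<le>g. complex_of_real (?M j i l) * (if block_pos g j l = 0 then 1 else 0)) =
          (\<Sum>l\<le>g. if l = 0 then (if j = 0 then of_real (?M j i 0) else 0) else 0)"
        using block_pos_inject[of _ g 0 j 0] by (intro sum.cong) (auto simp: block_pos_0)
      then show "ell2_nth (proj {0..} (T (basis_vec (- 1)))) (block_pos g j i) =
          ell2_nth (L2_set (?p 0) {..g} *\<^sub>R block_diag g ?M (basis_vec 0)) (block_pos g j i)"
        using c by (simp add: ell2_nth_coupling_vector[OF gen i] ell2_nth_orthogonal_block_diag[OF M i] U_mat_def del: ell2_nth_simps(9))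
    qed
  qed
qed

lemma adapted_basis_coupling_vector:
  assumes "adapted_basis T a b v"
  shows "proj {0..} (T (basis_vec (- 1))) = a 0 *\<^sub>R v 0"
proof -
  note v = adapted_basisD[OF assms]
  have "proj {0..} (v (- 1)) = 0" "proj {0..} (v (- 2)) = 0"
    by (rule proj_disjoint[OF v(3)]; auto)+
  then show ?thesis
    unfolding v(1)[symmetric] v(5) by (simp add: proj_add proj_scaleR v(2))
qed

lemma adapted_basis_flow:
  assumes v: "adapted_basis T a b v" and a: "\<And>n. a n > 0" and T: "class_A C T"
  shows "\<exists>w. adapted_basis (jacobi_flow C T) (\<lambda>n. a (n + 1)) (\<lambda>n. b (n + 1)) w"
proof -
  note v = v adapted_basisD[OF v]
  obtain U V c where flow: "\<And>x. jacobi_flow C T x = shift (- 1) (V (T (U (shift 1 x))))"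
    and lin: "linear U" "linear V" and UV: "\<And>x. U (V x) = x" "\<And>x. V (U x) = x"
    and adj: "\<And>x y. cinner (V x) y = cinner x (U y)"
    and U: "\<And>N x. N = {0..} \<or> N = {..<0} \<Longrightarrow> proj N x = x \<Longrightarrow> proj N (U x) = U x"
    and V: "\<And>N x. N = {0..} \<or> N = {..<0} \<Longrightarrow> proj N x = x \<Longrightarrow> proj N (V x) = V x"
    and c: "c > 0" "proj {0..} (T (basis_vec (- 1))) = c *\<^sub>R U (basis_vec 0)"
    by (rule jacobi_flow_unitary[OF T], rule that)
  have iso: "cinner (U x) (U y) = cinner x y" "cinner (V x) (V y) = cinner x y" for x y
    using adj[of "U x" y] by (simp_all add: UV adj)
  have U0: "U (basis_vec 0) = v 0"
  proof (rule scaleR_unit_eqD)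
    show "c *\<^sub>R U (basis_vec 0) = a 0 *\<^sub>R v 0"
      using adapted_basis_coupling_vector[OF v(1)] c by simp
  qed (use a c in \<open>simp_all add: iso v(5) cinner_basis_right\<close>)
  define w where "w n = shift (- 1) (V (v (n + 1)))" for n
  have "adapted_basis (jacobi_flow C T) (\<lambda>n. a (n + 1)) (\<lambda>n. b (n + 1)) w"
    unfolding adapted_basis_def
  proof (intro conjI allI impI)
    show w: "w (- 1) = basis_vec (- 1)"
      by (simp add: w_def U0[symmetric] UV)
    show "proj {0..} (w n) = w n" if n: "n \<ge> 0" for n
      unfolding proj_eq_self_iff
    proof (intro allI impI)
      fix k :: int assume k: "k \<notin> {0..}"
      have "proj {0..} (V (v (n + 1))) = V (v (n + 1))" using v(3)[of "n + 1"] n by (intro V) auto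
      then have "ell2_nth (V (v (n + 1))) (k + 1) = 0" if "k + 1 < 0"
        using that unfolding proj_eq_self_iff by auto
      \<comment> \<open>The shift by -1 would carry a component at 0 across the cut; there is none,
        since \<open>v (n + 1)\<close> is orthogonal to v_0 = U e_0.\<close>
      moreover have "ell2_nth (V (v (n + 1))) 0 = 0"
        using n by (simp add: cinner_basis_right[symmetric] adj U0 v(5))
      ultimately show "ell2_nth (w n) k = 0"
        using k by (cases "k = - 1") (auto simp: w_def)
    qed
    show "proj {..<0} (w n) = w n" if n: "n < 0" for n
    proof (cases "n = - 1")
      case False
      then have "proj {..<0} (V (v (n + 1))) = V (v (n + 1))" using v(4)[of "n + 1"] n by (intro V) auto
      then show ?thesis unfolding proj_eq_self_iff by (auto simp: w_def)
    qed (simp add: w)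
    show "cinner (w m) (w n) = (if m = n then 1 else 0)" for m n
      by (simp add: w_def iso v(5))
    show "jacobi_flow C T (w n) = a (n + 1) *\<^sub>R w (n - 1) + b (n + 1) *\<^sub>R w n + a (n + 1 + 1) *\<^sub>R w (n + 1)" for n
      using lin(2) linear_shift
      by (simp add: flow w_def UV v(6)[of "n + 1"] linear_add linear_scale)
  qed
  then show ?thesis by blast
qed

text \<open>Here u_0 = U e_0 holds by construction and u_{-1} = e_{-1} has to be proved. Computing
  P_- T u_0 twice gives a(-1) u_{-1} by the recursion and c e_{-1} by the rank one coupling.\<close>

lemma adapted_basis_flow_back:
  assumes v: "adapted_basis (jacobi_flow C T) a b v" and a: "\<And>n. a n > 0" and T: "class_A C T"
  shows "\<exists>u. adapted_basis T (\<lambda>n. a (n - 1)) (\<lambda>n. b (n - 1)) u"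
proof -
  note v = v adapted_basisD[OF v]
  obtain U V c where flow: "\<And>x. jacobi_flow C T x = shift (- 1) (V (T (U (shift 1 x))))"
    and lin: "linear U" "linear V" and UV: "\<And>x. U (V x) = x" "\<And>x. V (U x) = x"
    and adj: "\<And>x y. cinner (V x) y = cinner x (U y)"
    and U: "\<And>N x. N = {0..} \<or> N = {..<0} \<Longrightarrow> proj N x = x \<Longrightarrow> proj N (U x) = U x"
    and V: "\<And>N x. N = {0..} \<or> N = {..<0} \<Longrightarrow> proj N x = x \<Longrightarrow> proj N (V x) = V x"
    and c: "c > 0" "proj {0..} (T (basis_vec (- 1))) = c *\<^sub>R U (basis_vec 0)"
    by (rule jacobi_flow_unitary[OF T], rule that)
  have iso: "cinner (U x) (U y) = cinner x y" for x y
    using adj[of "U x" y] by (simp add: UV)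
  obtain p q where gen: "generating_coeffs C T p q" "length C = length C" and bounded: "bounded_op T"
    using T by (auto simp: class_A_def)
  note sym = class_A_symmetric[OF gen bounded] and far = class_A_far[OF gen]
  define u where "u n = U (shift 1 (v (n - 1)))" for n
  have u0: "u 0 = U (basis_vec 0)" by (simp add: u_def v(2))
  have orth: "cinner (u m) (u n) = (if m = n then 1 else 0)" for m n
    by (simp add: u_def iso v(5))
  have plus: "proj {0..} (u n) = u n" if n: "n \<ge> 0" for n
    unfolding u_def
  proof (rule U)
    show "proj {0..} (shift 1 (v (n - 1))) = shift 1 (v (n - 1))"
    proof (cases "n = 0")
      case False
      then show ?thesis using v(3)[of "n - 1"] n unfolding proj_eq_self_iff by auto
    qed (simp add: v(2))
  qed simp
  have minus: "proj {..<0} (u n) = u n" if n: "n < 0" for n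
    unfolding u_def
  proof (rule U)
    \<comment> \<open>The shift by 1 moves index -1 to 0, so the component at -1 must vanish; it
      does by orthogonality to v_{-1} = e_{-1}.\<close>
    have "ell2_nth (v (n - 1)) (- 1) = cinner (v (n - 1)) (v (- 1))"
      by (simp add: v(2) cinner_basis_right)
    then have "ell2_nth (v (n - 1)) (- 1) = 0" using n by (simp add: v(5))
    moreover have "ell2_nth (v (n - 1)) k = 0" if "k \<ge> 0" for k
      using v(4)[of "n - 1"] n that unfolding proj_eq_self_iff by auto
    ultimately have "ell2_nth (v (n - 1)) (k - 1) = 0" if "k \<ge> 0" for k
      using that by (cases "k = 0") auto
    then show "proj {..<0} (shift 1 (v (n - 1))) = shift 1 (v (n - 1))"
      unfolding proj_eq_self_iff by auto
  qed simp
  have rec: "T (u n) = a (n - 1) *\<^sub>R u (n - 1) + b (n - 1) *\<^sub>R u n + a n *\<^sub>R u (n + 1)" for n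
  proof -
    have "T (u n) = U (shift 1 (jacobi_flow C T (v (n - 1))))"
      by (simp add: flow u_def UV)
    then show ?thesis
      using lin(1) linear_shift by (simp add: v(6)[of "n - 1"] u_def linear_add linear_scale)
  qed
  have plus_zero: "proj {..<0} (u n) = 0" if "n \<ge> 0" for n
    by (rule proj_disjoint[OF plus[OF that]]) auto
  have "a (- 1) *\<^sub>R u (- 1) = proj {..<0} (T (u 0))"
    by (simp add: rec proj_add proj_scaleR minus plus_zero)
  also have "\<dots> = cscale (cinner (u 0) (c *\<^sub>R u 0)) (basis_vec (- 1))"
    by (subst coupling_from_plus[OF sym far plus]) (simp_all add: c(2) u0[symmetric])
  also have "\<dots> = c *\<^sub>R basis_vec (- 1)"
    by (simp add: cinner_scaleR_right orth) (simp add: scaleR_ell2_def)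
  finally have u_minus_1: "u (- 1) = basis_vec (- 1)"
    by (rule scaleR_unit_eqD) (use a c orth in \<open>simp_all add: cinner_basis_right\<close>)
  have "adapted_basis T (\<lambda>n. a (n - 1)) (\<lambda>n. b (n - 1)) u"
    unfolding adapted_basis_def using u_minus_1 plus minus orth rec by simp
  then show ?thesis by blast
qed

section \<open>Reading off the coefficients along the orbit\<close>

lemma adapted_basis_coefficients:
  assumes v: "adapted_basis T a b v" and a: "a 0 > 0"
    and gen: "generating_coeffs C T p q" "length C = g"
  shows "a 0 = L2_set (p 0) {..g}" "b (- 1) = q (- 1) g * p (- 1) g"
proof -
  note vD = adapted_basisD[OF v]
  have "norm (v 0) = 1"
    using vD(4)[of 0 0] by (simp add: norm_eq_1_iff)
  then show "a 0 = L2_set (p 0) {..g}"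
    using norm_coupling_vector[OF gen] a unfolding adapted_basis_coupling_vector[OF v] by simp
  have "entry T (- 1) (- 1) = cinner (T (v (- 1))) (v (- 1))"
    by (simp add: entry_def vD(1))
  also have "\<dots> = of_real (b (- 1))"
    by (simp add: vD(4,5) cinner_add_left cinner_scaleR_left)
  finally show "b (- 1) = q (- 1) g * p (- 1) g"
    unfolding entry_minus_1[OF gen] by (simp only: of_real_eq_iff)
qed

text \<open>Identifies the coefficients hidden in \<open>associated_jacobi\<close> with the given
  \<open>a\<close> and \<open>b\<close>.\<close>

lemma jacobi_matrix_unique:
  assumes "jacobi_matrix J a b" "jacobi_matrix J a' b'"
  shows "a = a'" "b = b'"
proof -
  have "ell2_nth (J (basis_vec n)) (n - 1) = of_real (a n)" "ell2_nth (J (basis_vec n)) n = of_real (b n)"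
    if "jacobi_matrix J a b" for a b n
    using that by (auto simp: jacobi_matrix_def)
  from this[OF assms(1)] this[OF assms(2)] show "a = a'" "b = b'"
    by (auto simp: fun_eq_iff)
qed

theorem corollary1p16:
  fixes g :: nat and C :: "real list"
    and A J :: "ell2 \<Rightarrow> ell2" and orb :: "int \<Rightarrow> ell2 \<Rightarrow> ell2"
    and p q :: "int \<Rightarrow> int \<Rightarrow> nat \<Rightarrow> real" and a b :: "int \<Rightarrow> real"
  assumes "g \<ge> 1" and "length C = g" and "distinct C"
    and "A \<in> GMP C"
    and "\<forall>n. orb n \<in> GMP C" and "orb 0 = A" and "\<forall>n. orb (n + 1) = jacobi_flow C (orb n)"
    and "\<forall>n. generating_coeffs C (orb n) (p n) (q n)"
    and "associated_jacobi C A J" and "jacobi_matrix J a b"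
  shows "\<forall>n. a n = L2_set (p n 0) {..g} \<and> b (n - 1) = q n (- 1) g * p n (- 1) g"
proof
  fix n
  have class_A: "class_A C (orb n)" for n using assms(5) by (simp add: GMP_def)
  have gen: "generating_coeffs C (orb n) (p n) (q n)" for n using assms(8) by blast
  have a: "a n > 0" for n using assms(10) by (simp add: jacobi_matrix_def)
  have bounded: "bounded_op (orb 0)" using class_A by (simp add: class_A_def)
  have "\<exists>v. adapted_basis (orb 0) a b v"
  proof -
    define p0 where "p0 = L2_set (p_coeffs C A 0) {..length C}"
    define e0 where "e0 = (1 / p0) *\<^sub>R proj {0..} (orb 0 (basis_vec (- 1)))"
    obtain a' b' where J': "jacobi_matrix J a' b'" "a' 0 = p0"
      and res: "\<And>z. Im z \<noteq> 0 \<Longrightarrow> resolvent_fun {0..} J (basis_vec 0) z = resolvent_fun {0..} (orb 0) e0 z"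
        "\<And>z. Im z \<noteq> 0 \<Longrightarrow> resolvent_fun {..<0} J (basis_vec (- 1)) z = resolvent_fun {..<0} (orb 0) (basis_vec (- 1)) z"
      using assms(9) unfolding associated_jacobi_def Let_def p0_def e0_def assms(6) by blast
    have "proj {0..} (orb 0 (basis_vec (- 1))) = a 0 *\<^sub>R e0"
      using a[of 0] J' jacobi_matrix_unique[OF assms(10) J'(1)] by (simp add: e0_def)
    then show ?thesis
      using res by (intro adapted_basis_exists[OF bounded class_A_symmetric[OF gen assms(2) bounded]
          class_A_far[OF gen assms(2)] assms(10)]) simp_all
  qed
  \<comment> \<open>After \<open>n\<close> steps, the indices 0 and -1 of the shifted sequences are
    n and n - 1, as in the claim.\<close>
  then have "\<exists>v. adapted_basis (orb n) (\<lambda>k. a (k + n)) (\<lambda>k. b (k + n)) v"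
  proof (induction n rule: int_induct[where k = 0])
    case base
    then show ?case by simp
  next
    case (step1 n)
    then obtain v where "adapted_basis (orb n) (\<lambda>k. a (k + n)) (\<lambda>k. b (k + n)) v" by blast
    from adapted_basis_flow[OF this a class_A] show ?case
      using assms(7)[rule_format, of n] by (simp add: ac_simps)
  next
    case (step2 n)
    then obtain v where "adapted_basis (orb n) (\<lambda>k. a (k + n)) (\<lambda>k. b (k + n)) v" by blast
    then have "adapted_basis (jacobi_flow C (orb (n - 1))) (\<lambda>k. a (k + n)) (\<lambda>k. b (k + n)) v"
      using assms(7)[rule_format, of "n - 1"] by simp
    from adapted_basis_flow_back[OF this a class_A] show ?case
      by (simp add: algebra_simps)
  qed
  then obtain v where v: "adapted_basis (orb n) (\<lambda>k. a (k + n)) (\<lambda>k. b (k + n)) v" by blast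
  show "a n = L2_set (p n 0) {..g} \<and> b (n - 1) = q n (- 1) g * p n (- 1) g"
    using adapted_basis_coefficients[OF v a gen assms(2)] by (simp add: algebra_simps)
qed

end
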